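(* For $i=1,2$ let $R_i$ be a unital ring whose additive group is finitely generated and torsion-free, $M_i\subseteq R_i^\times$ an abelian submonoid such that ${\rm span}_{\mathbb Z}(M_i)$ has finite index in $R_i$, and $\mathcal L_i\subseteq R_i$ a full rank subgroup invariant under left multiplication by $M_i$. Assume that there is $a\in M_1$ such that $x\mapsto(1-a)x$ is injective on $\mathcal L_1$, and similarly there is $a'\in M_2$ such that $x\mapsto(1-a')x$ is injective on $\mathcal L_2$. If the topological groupoids $(M_1^{-1}\mathcal L_1\rtimes\langle M_1\rangle)\ltimes\overline{\mathcal L_1}$ and $(M_2^{-1}\mathcal L_2\rtimes\langle M_2\rangle)\ltimes\overline{\mathcal L_2}$ are isomorphic, then there are $\mathbb Q$-algebra isomorphisms $\varphi_1\colon\mathbb QR_1\to\mathbb QR_2$ and $\varphi_2\colon\mathbb QR_2\to\mathbb QR_1$ with $\varphi_1(M_1)\subseteq\widetilde{M_2}$ and $\varphi_2(M_2)\subseteq\widetilde{M_1}$.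
   Context: $\mathbb QR=\mathbb Q\otimes_{\mathbb Z}R$; $R^\times$ is the monoid of left regular elements; $\langle M\rangle$ is the subgroup of $(\mathbb QR)^*$ generated by $M$; full rank means ${\rm rk}\,\mathcal L={\rm rk}\,R$; $M^{-1}\mathcal L=\bigcup_{a\in M}a^{-1}\mathcal L\subseteq\mathbb QR$. $\mathcal O$ is the set of elements of $\mathbb QR$ integral over $\mathbb Z$, and $\widetilde M=\langle M\rangle\cap\mathcal O$. The constructible subgroups of $M\curvearrowright\mathcal L$ form the smallest family of subgroups of $\mathcal L$ containing $\mathcal L$ and closed under $C\mapsto aC$ and $C\mapsto\{x\in\mathcal L:ax\in C\}$ ($a\in M$); they have finite index and $\overline{\mathcal L}=\varprojlim_C\mathcal L/C$. The group $M^{-1}\mathcal L\rtimes\langle M\rangle$ acts on $M^{-1}\mathcal L$ by $(b,u).x=b+ux$; its restriction to $\mathcal L$ is a partial action that extends uniquely to a partial action on $\overline{\mathcal L}$ by homeomorphisms between open sets, and the groupoid is its partial transformation groupoid. *)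

theory Defs
  imports "HOL-Analysis.Analysis"
begin

section \<open>Algebraic preliminaries (inside an ambient ring playing the role of QR)\<close>

definition zspan :: "'a::ring_1 set \<Rightarrow> 'a set" where
  "zspan S = {x. \<exists>F c. finite F \<and> F \<subseteq> S \<and> x = (\<Sum>s\<in>F. of_int (c s) * s)}"

definition zindep :: "'a::ring_1 set \<Rightarrow> bool" where
  "zindep S \<longleftrightarrow> (\<forall>F c. finite F \<and> F \<subseteq> S \<and> (\<Sum>s\<in>F. of_int (c s) * s) = 0
                       \<longrightarrow> (\<forall>s\<in>F. c s = 0))"

definition zrank :: "'a::ring_1 set \<Rightarrow> nat" where
  "zrank G = Sup {card S | S. finite S \<and> S \<subseteq> G \<and> zindep S}"

definition add_subgroup :: "'a::ring_1 set \<Rightarrow> bool" where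
  "add_subgroup G \<longleftrightarrow> 0 \<in> G \<and> (\<forall>x\<in>G. - x \<in> G) \<and> (\<forall>x\<in>G. \<forall>y\<in>G. x + y \<in> G)"

definition unital_subring :: "'a::ring_1 set \<Rightarrow> bool" where
  "unital_subring R \<longleftrightarrow> add_subgroup R \<and> 1 \<in> R \<and> (\<forall>x\<in>R. \<forall>y\<in>R. x * y \<in> R)"

definition fin_gen :: "'a::ring_1 set \<Rightarrow> bool" where
  "fin_gen G \<longleftrightarrow> (\<exists>S. finite S \<and> S \<subseteq> G \<and> zspan S = G)"

text \<open>The ambient ring (the whole type) is QR = Q \<otimes> R: every positive integer is
  invertible (so the ambient ring is a Q-algebra and R is torsion-free), and every
  element is of the form r/n with r in R.\<close>
definition is_QR :: "'a::ring_1 set \<Rightarrow> bool" where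
  "is_QR R \<longleftrightarrow> (\<forall>n::nat. n > 0 \<longrightarrow> (\<exists>y::'a. of_nat n * y = 1 \<and> y * of_nat n = 1))
             \<and> (\<forall>x::'a. \<exists>r\<in>R. \<exists>n::nat. n > 0 \<and> of_nat n * x = r)"

definition left_regular :: "'a::ring_1 set \<Rightarrow> 'a \<Rightarrow> bool" where
  "left_regular R a \<longleftrightarrow> a \<in> R \<and> (\<forall>x\<in>R. a * x = 0 \<longrightarrow> x = 0)"

definition abelian_submonoid_regular :: "'a::ring_1 set \<Rightarrow> 'a set \<Rightarrow> bool" where
  "abelian_submonoid_regular R M \<longleftrightarrow> M \<subseteq> {a. left_regular R a} \<and> 1 \<in> M
      \<and> (\<forall>a\<in>M. \<forall>b\<in>M. a * b \<in> M \<and> a * b = b * a)"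

definition finite_index :: "'a::ring_1 set \<Rightarrow> 'a set \<Rightarrow> bool" where
  "finite_index H G \<longleftrightarrow> finite ((\<lambda>x. (\<lambda>h. x + h) ` H) ` G)"

definition qunit :: "'a::ring_1 \<Rightarrow> bool" where
  "qunit x \<longleftrightarrow> (\<exists>y. x * y = 1 \<and> y * x = 1)"

definition qinv :: "'a::ring_1 \<Rightarrow> 'a" where
  "qinv x = (THE y. x * y = 1 \<and> y * x = 1)"

inductive_set grp_gen :: "'a::ring_1 set \<Rightarrow> 'a set" for M where
  one: "1 \<in> grp_gen M"
| gen: "a \<in> M \<Longrightarrow> a \<in> grp_gen M"
| inv: "a \<in> M \<Longrightarrow> qinv a \<in> grp_gen M"
| mult: "x \<in> grp_gen M \<Longrightarrow> y \<in> grp_gen M \<Longrightarrow> x * y \<in> grp_gen M"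

definition zintegral :: "'a::ring_1 \<Rightarrow> bool" where
  "zintegral x \<longleftrightarrow> (\<exists>n c. x ^ n + (\<Sum>i<n. of_int (c i) * x ^ i) = 0)"

definition Mtilde :: "'a::ring_1 set \<Rightarrow> 'a set" where
  "Mtilde M = grp_gen M \<inter> {x. zintegral x}"

definition MinvL :: "'a::ring_1 set \<Rightarrow> 'a set \<Rightarrow> 'a set" where
  "MinvL M L = {qinv a * x | a x. a \<in> M \<and> x \<in> L}"

text \<open>Q-algebra isomorphism between two Q-algebras (ring isomorphisms are automatically Q-linear).\<close>
definition qalg_iso :: "('a::ring_1 \<Rightarrow> 'b::ring_1) \<Rightarrow> bool" where
  "qalg_iso \<phi> \<longleftrightarrow> bij \<phi> \<and> \<phi> 1 = 1 \<and> (\<forall>x y. \<phi> (x + y) = \<phi> x + \<phi> y)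
                     \<and> (\<forall>x y. \<phi> (x * y) = \<phi> x * \<phi> y)"

inductive_set constructible :: "'a::ring_1 set \<Rightarrow> 'a set \<Rightarrow> 'a set set" for M L where
  base: "L \<in> constructible M L"
| mul: "C \<in> constructible M L \<Longrightarrow> a \<in> M \<Longrightarrow> (\<lambda>x. a * x) ` C \<in> constructible M L"
| pre: "C \<in> constructible M L \<Longrightarrow> a \<in> M \<Longrightarrow> {x\<in>L. a * x \<in> C} \<in> constructible M L"

definition cosets :: "'a::ring_1 set \<Rightarrow> 'a set \<Rightarrow> 'a set set" where
  "cosets L C = (\<lambda>x. (\<lambda>c. x + c) ` C) ` L"

text \<open>Lbar = inverse limit of the discrete groups L/C over constructible C (ordered by
  inclusion), with the inverse limit (subspace of product) topology.\<close>
definition Lbar_top :: "'a::ring_1 set \<Rightarrow> 'a set \<Rightarrow> ('a set \<Rightarrow> 'a set) topology" where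
  "Lbar_top M L = subtopology
     (product_topology (\<lambda>C. discrete_topology (cosets L C)) (constructible M L))
     {\<xi>. \<forall>C\<in>constructible M L. \<forall>D\<in>constructible M L. C \<subseteq> D \<longrightarrow> \<xi> C \<subseteq> \<xi> D}"

definition iota :: "'a::ring_1 set \<Rightarrow> 'a set \<Rightarrow> 'a \<Rightarrow> ('a set \<Rightarrow> 'a set)" where
  "iota M L x = restrict (\<lambda>C. (\<lambda>c. x + c) ` C) (constructible M L)"

text \<open>The group M^{-1}L \<rtimes> <M>, elements (b,u), acting by (b,u).x = b + u x.\<close>
definition grpG :: "'a::ring_1 set \<Rightarrow> 'a set \<Rightarrow> ('a \<times> 'a) set" where
  "grpG M L = MinvL M L \<times> grp_gen M"

definition act :: "'a::ring_1 \<times> 'a \<Rightarrow> 'a \<Rightarrow> 'a" where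
  "act g x = fst g + snd g * x"

definition dom0 :: "'a::ring_1 set \<Rightarrow> 'a \<times> 'a \<Rightarrow> 'a set" where
  "dom0 L g = {x\<in>L. act g x \<in> L}"

text \<open>Extension to Lbar: domain = closure of the image of dom0, map = continuous extension.\<close>
definition pdom :: "'a::ring_1 set \<Rightarrow> 'a set \<Rightarrow> 'a \<times> 'a \<Rightarrow> ('a set \<Rightarrow> 'a set) set" where
  "pdom M L g = (Lbar_top M L) closure_of (iota M L ` dom0 L g)"

definition theta :: "'a::ring_1 set \<Rightarrow> 'a set \<Rightarrow> 'a \<times> 'a \<Rightarrow> ('a set \<Rightarrow> 'a set) \<Rightarrow> ('a set \<Rightarrow> 'a set)" where
  "theta M L g \<xi> = (THE \<eta>. limitin (Lbar_top M L) (\<lambda>y. iota M L (act g y)) \<eta>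
       (inf (filtercomap (iota M L) (nhdsin (Lbar_top M L) \<xi>)) (principal (dom0 L g))))"

definition gpd_arrows :: "'a::ring_1 set \<Rightarrow> 'a set \<Rightarrow> (('a \<times> 'a) \<times> ('a set \<Rightarrow> 'a set)) set" where
  "gpd_arrows M L = {(g, \<xi>). g \<in> grpG M L \<and> \<xi> \<in> pdom M L g}"

definition gpd_top :: "'a::ring_1 set \<Rightarrow> 'a set \<Rightarrow> (('a \<times> 'a) \<times> ('a set \<Rightarrow> 'a set)) topology" where
  "gpd_top M L = subtopology (prod_topology (discrete_topology (grpG M L)) (Lbar_top M L))
                             (gpd_arrows M L)"

definition gpd_src :: "('a \<times> 'a) \<times> ('a set \<Rightarrow> 'a set) \<Rightarrow> ('a set \<Rightarrow> 'a set)" where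
  "gpd_src \<gamma> = snd \<gamma>"

definition gpd_rng :: "'a::ring_1 set \<Rightarrow> 'a set \<Rightarrow> ('a \<times> 'a) \<times> ('a set \<Rightarrow> 'a set) \<Rightarrow> ('a set \<Rightarrow> 'a set)" where
  "gpd_rng M L \<gamma> = theta M L (fst \<gamma>) (snd \<gamma>)"

text \<open>(g, theta_h x) \<cdot> (h, x) = (gh, x), with (b,u)(c,v) = (b + u c, u v).\<close>
definition gpd_comp :: "('a::ring_1 \<times> 'a) \<times> ('a set \<Rightarrow> 'a set) \<Rightarrow> ('a \<times> 'a) \<times> ('a set \<Rightarrow> 'a set)
                        \<Rightarrow> ('a \<times> 'a) \<times> ('a set \<Rightarrow> 'a set)" where
  "gpd_comp \<gamma> \<delta> = ((fst (fst \<gamma>) + snd (fst \<gamma>) * fst (fst \<delta>), snd (fst \<gamma>) * snd (fst \<delta>)), snd \<delta>)"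

definition top_gpd_iso ::
  "'x set \<Rightarrow> 'x topology \<Rightarrow> ('x \<Rightarrow> 'u) \<Rightarrow> ('x \<Rightarrow> 'u) \<Rightarrow> ('x \<Rightarrow> 'x \<Rightarrow> 'x) \<Rightarrow>
   'y set \<Rightarrow> 'y topology \<Rightarrow> ('y \<Rightarrow> 'v) \<Rightarrow> ('y \<Rightarrow> 'v) \<Rightarrow> ('y \<Rightarrow> 'y \<Rightarrow> 'y) \<Rightarrow> bool" where
  "top_gpd_iso A1 T1 s1 r1 c1 A2 T2 s2 r2 c2 \<longleftrightarrow>
     (\<exists>\<Phi>. bij_betw \<Phi> A1 A2 \<and> homeomorphic_map T1 T2 \<Phi> \<and>
        (\<forall>\<gamma>\<in>A1. \<forall>\<delta>\<in>A1. (s1 \<gamma> = r1 \<delta> \<longleftrightarrow> s2 (\<Phi> \<gamma>) = r2 (\<Phi> \<delta>)) \<and>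
                         (s1 \<gamma> = r1 \<delta> \<longrightarrow> \<Phi> (c1 \<gamma> \<delta>) = c2 (\<Phi> \<gamma>) (\<Phi> \<delta>))))"

definition groupoids_iso :: "'a::ring_1 set \<Rightarrow> 'a set \<Rightarrow> 'b::ring_1 set \<Rightarrow> 'b set \<Rightarrow> bool" where
  "groupoids_iso M1 L1 M2 L2 \<longleftrightarrow>
     top_gpd_iso (gpd_arrows M1 L1) (gpd_top M1 L1) gpd_src (gpd_rng M1 L1) gpd_comp
                 (gpd_arrows M2 L2) (gpd_top M2 L2) gpd_src (gpd_rng M2 L2) gpd_comp"

end

theory Submission
  imports Defs
begin

text \<open>The algebra \<open>\<rat>R\<close> is commutative, since the abelian monoid \<open>M\<close> spans it. A groupoid
  isomorphism \<open>\<Phi>\<close> has a locally constant group component \<open>c(g, x) \<in> M\<^sub>2\<^sup>-\<^sup>1\<L>\<^sub>2 \<rtimes> \<langle>M\<^sub>2\<rangle>\<close>, which is a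
  cocycle. As \<open>\<L>\<^sub>1\<close> is finitely generated and its completion is compact, there is a finite index
  subgroup \<open>H\<close> such that \<open>c(b, x)\<close> depends only on \<open>x\<close> modulo \<open>H\<close> for all translations \<open>b \<in> \<L>\<^sub>1\<close>;
  hence \<open>\<rho>(b) = c(b, 0)\<close> is a homomorphism on \<open>H\<close>. For \<open>a \<in> M\<^sub>1\<close> the cocycle identity gives
  \<open>\<rho>(ab) = c(a, 0) \<rho>(b) c(a, 0)\<^sup>-\<^sup>1\<close> for \<open>b\<close> in a finite index subgroup, so \<open>\<rho>((1 - a)b)\<close> is a
  commutator and lies in \<open>M\<^sub>2\<^sup>-\<^sup>1\<L>\<^sub>2\<close>. If \<open>1 - a\<close> is injective, then \<open>\<rho>\<close> therefore extends to a
  \<open>\<rat>\<close>-linear map \<open>\<alpha> : \<rat>R\<^sub>1 \<rightarrow> \<rat>R\<^sub>2\<close> with \<open>\<alpha>(ux) = \<tau>(u)\<alpha>(x)\<close>, where \<open>\<tau>(u) \<in> \<langle>M\<^sub>2\<rangle>\<close> is the linear part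
  of \<open>c(u, 0)\<close>. It is injective because \<open>\<Phi>\<close> is. The inverse of \<open>\<Phi>\<close> yields such a map \<open>\<beta>\<close> in the
  other direction; as \<open>\<alpha> \<circ> \<beta>\<close> is an injective endomorphism of a finite-dimensional space, \<open>\<alpha>\<close> is
  bijective. Finally \<open>\<alpha>(xy)\<alpha>(1) = \<alpha>(x)\<alpha>(y)\<close>, because both sides are additive in \<open>x\<close> and agree for
  \<open>x \<in> M\<^sub>1\<close>, so \<open>\<alpha>(1)\<close> is a unit and \<open>x \<mapsto> \<alpha>(x)\<alpha>(1)\<^sup>-\<^sup>1\<close> is the desired algebra isomorphism.\<close>

hide_const (open) Measure_Space.additive
hide_fact (open) Measure_Space.additive_def

section \<open>Subgroups of the additive group of a ring\<close>

lemma add_subgroup_of_nat_mult: "add_subgroup H \<Longrightarrow> x \<in> H \<Longrightarrow> of_nat n * x \<in> H"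
  by (induction n) (auto simp: distrib_right add_subgroup_def)

lemma add_subgroup_of_int_mult: "add_subgroup H \<Longrightarrow> x \<in> H \<Longrightarrow> of_int k * x \<in> H"
  using add_subgroup_of_nat_mult by (cases k rule: int_cases2) (auto simp: add_subgroup_def)

interpretation zmod: module "\<lambda>k x::'a::ring_1. of_int k * x"
  rewrites "module.subspace (\<lambda>k x::'a. of_int k * x) = add_subgroup"
    and "module.span (\<lambda>k x::'a. of_int k * x) = zspan"
proof -
  show "module (\<lambda>k x::'a. of_int k * x)"
    by unfold_locales (simp_all add: distrib_left distrib_right mult.assoc)
  then interpret module "\<lambda>k x::'a. of_int k * x" .
  show "subspace = add_subgroup"
  proof (intro ext iffI)
    show "add_subgroup H" if "subspace H" for H
      using that subspace_neg unfolding add_subgroup_def subspace_def by blast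
    show "subspace H" if "add_subgroup H" for H
      using that add_subgroup_of_int_mult unfolding add_subgroup_def subspace_def by blast
  qed
  show "span = zspan"
    by (intro ext) (auto simp: span_explicit zspan_def)
qed

(* As simp rule, scale_scale loops with mult.assoc. *)
declare zmod.scale_scale [simp del]

lemma additive_of_nat_mult:
  fixes f :: "'a::ring_1 \<Rightarrow> 'b::ring_1"
  shows "additive f \<Longrightarrow> f (of_nat n * x) = of_nat n * f x"
  by (induction n) (simp_all add: additive.zero additive.add distrib_right)

lemma additive_of_int_mult:
  fixes f :: "'a::ring_1 \<Rightarrow> 'b::ring_1"
  shows "additive f \<Longrightarrow> f (of_int k * x) = of_int k * f x"
  by (cases k rule: int_cases2) (simp_all add: additive_of_nat_mult additive.minus)

lemma additive_mult_left: "additive ((*) (a :: 'a::ring_1))"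
  by (simp add: additive_def distrib_left)

lemma add_subgroup_image:
  assumes f: "additive f" and H: "add_subgroup H"
  shows "add_subgroup (f ` H)"
  unfolding add_subgroup_def
proof (intro conjI ballI; (elim imageE)?)
  show "0 \<in> f ` H" using additive.zero[OF f] zmod.subspace_0[OF H] by force
  show "- y \<in> f ` H" if "y = f x" "x \<in> H" for x y
    using that zmod.subspace_neg[OF H]
    by (intro image_eqI[of _ _ "- x"]) (simp_all add: additive.minus[OF f])
  show "y + y' \<in> f ` H" if "y = f x" "x \<in> H" "y' = f x'" "x' \<in> H" for x x' y y'
    using that zmod.subspace_add[OF H]
    by (intro image_eqI[of _ _ "x + x'"]) (simp_all add: additive.add[OF f])
qed

lemma add_subgroup_vimage: "additive f \<Longrightarrow> add_subgroup H \<Longrightarrow> add_subgroup (f -` H)"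
  by (auto simp: add_subgroup_def additive.zero additive.minus additive.add)

lemma coset_eq_iff:
  assumes H: "add_subgroup H"
  shows "(+) x ` H = (+) y ` H \<longleftrightarrow> x - y \<in> H"
proof
  assume "(+) x ` H = (+) y ` H"
  moreover have "x \<in> (+) x ` H" using zmod.subspace_0[OF H] by force
  ultimately show "x - y \<in> H" by auto
next
  have "(+) z ` H \<subseteq> (+) w ` H" if "z - w \<in> H" for z w
  proof safe
    fix h assume "h \<in> H"
    then have "(z - w) + h \<in> H" using that H by (simp add: zmod.subspace_add)
    then show "z + h \<in> (+) w ` H" by (rule image_eqI[rotated]) simp
  qed
  moreover assume "x - y \<in> H"
  moreover from this have "y - x \<in> H" using zmod.subspace_neg[OF H] by force
  ultimately show "(+) x ` H = (+) y ` H" by blast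
qed

section \<open>Finitely generated subgroups\<close>

lemma int_subgroup_principal:
  assumes J: "add_subgroup (J :: int set)"
  obtains d where "J = range ((*) d)"
proof (cases "J \<subseteq> {0}")
  case True
  then have "J = range ((*) 0)" using zmod.subspace_0[OF J] by auto
  then show ?thesis by (rule that)
next
  case False
  then obtain k where "k \<in> J" "k \<noteq> 0" by blast
  then have "\<exists>n. 0 < n \<and> int n \<in> J"
    using zmod.subspace_neg[OF J, of k] by (intro exI[of _ "nat \<bar>k\<bar>"]) (simp add: abs_if)
  then obtain d where d: "0 < d" "int d \<in> J" and least: "\<And>n. n < d \<Longrightarrow> \<not> (0 < n \<and> int n \<in> J)"
    using exists_least_iff[of "\<lambda>n. 0 < n \<and> int n \<in> J"] by blast
  have "k \<in> range ((*) (int d))" if "k \<in> J" for k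
  proof -
    have "k mod int d = k - of_int (k div int d) * int d" by (simp add: minus_div_mult_eq_mod)
    also have "\<dots> \<in> J" using that d(2) J by (intro zmod.subspace_diff zmod.subspace_scale)
    finally have "k mod int d \<in> J" .
    moreover have "0 \<le> k mod int d" "k mod int d < int d" using d(1) by simp_all
    ultimately have "k mod int d = 0"
      using least[of "nat (k mod int d)"] by (cases "k mod int d = 0") (simp_all add: nat_less_iff)
    then show ?thesis by auto
  qed
  moreover have "range ((*) (int d)) \<subseteq> J"
    using zmod.subspace_scale[OF J d(2)] by (auto simp: mult.commute)
  ultimately have "J = range ((*) (int d))" by blast
  then show ?thesis by (rule that)
qed

lemma fin_gen_if_fin_gen_Int_zspan:
  assumes G: "add_subgroup G" "G \<subseteq> zspan (insert t T)" and fin: "fin_gen (G \<inter> zspan T)"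
  shows "fin_gen G"
proof -
  define J where "J = (\<lambda>k. of_int k * t) -` zspan (G \<union> T)"
  have J_iff: "k \<in> J \<longleftrightarrow> (\<exists>x\<in>G. x - of_int k * t \<in> zspan T)" for k
  proof -
    have "zspan G = G" using G(1) by simp
    then have "k \<in> J \<longleftrightarrow> (\<exists>x\<in>G. \<exists>w\<in>zspan T. of_int k * t = x + w)"
      unfolding J_def zmod.span_Un by blast
    also have "\<dots> \<longleftrightarrow> (\<exists>x\<in>G. of_int k * t - x \<in> zspan T)"
      by (metis add.commute add_diff_cancel_right' diff_add_cancel)
    also have "\<dots> \<longleftrightarrow> (\<exists>x\<in>G. x - of_int k * t \<in> zspan T)"
      by (metis minus_diff_eq zmod.span_neg)
    finally show ?thesis .
  qed
  have "additive (\<lambda>k. of_int k * t)" by (rule additive.intro) (simp add: distrib_right)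
  then have "add_subgroup J" unfolding J_def by (rule add_subgroup_vimage) simp
  then obtain d where d: "J = range ((*) d)" by (rule int_subgroup_principal)
  then have "d \<in> J" by (metis mult_1_right rangeI)
  then obtain g where g: "g \<in> G" "g - of_int d * t \<in> zspan T" by (auto simp: J_iff)
  obtain S where S: "finite S" "S \<subseteq> G \<inter> zspan T" "zspan S = G \<inter> zspan T"
    using fin by (auto simp: fin_gen_def)
  have "x \<in> zspan (insert g S)" if x: "x \<in> G" for x
  proof -
    obtain k where k: "x - of_int k * t \<in> zspan T" using G(2) x by (auto simp: zmod.span_insert)
    then have "k \<in> J" using x by (auto simp: J_iff)
    then obtain q where q: "k = q * d" unfolding d by (auto simp: mult.commute)
    have "x - of_int q * g = (x - of_int k * t) - of_int q * (g - of_int d * t)"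
      by (simp add: q right_diff_distrib mult.assoc)
    also have "\<dots> \<in> zspan T" by (rule zmod.span_diff[OF k zmod.span_scale[OF g(2)]])
    finally have "x - of_int q * g \<in> zspan S"
      using x g(1) G(1) S(3) by (simp add: zmod.subspace_diff zmod.subspace_scale)
    then show ?thesis by (auto simp: zmod.span_insert)
  qed
  moreover have "insert g S \<subseteq> G" using g(1) S(2) by blast
  moreover from this have "zspan (insert g S) \<subseteq> G" using G(1) by (rule zmod.span_minimal)
  ultimately show ?thesis using S(1) unfolding fin_gen_def by blast
qed

lemma fin_gen_subgroup:
  assumes G: "fin_gen G" and H: "add_subgroup H" "H \<subseteq> G"
  shows "fin_gen H"
proof -
  obtain T where "finite T" "zspan T = G" using G by (auto simp: fin_gen_def)
  moreover have "fin_gen H'" if "add_subgroup H'" "H' \<subseteq> zspan T" for H'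
    using \<open>finite T\<close> that
  proof (induction T arbitrary: H' rule: finite_induct)
    case empty
    then have "zspan {} = H'" using zmod.subspace_0 by auto
    then show ?case unfolding fin_gen_def by blast
  next
    case (insert t T)
    then have "fin_gen (H' \<inter> zspan T)" by (simp add: zmod.subspace_inter)
    with insert.prems show ?case by (rule fin_gen_if_fin_gen_Int_zspan)
  qed
  ultimately show ?thesis using H by simp
qed

lemma fin_gen_chain_stabilizes:
  fixes A :: "nat \<Rightarrow> 'a::ring_1 set"
  assumes "incseq A" and sub: "\<And>n. add_subgroup (A n)" and "fin_gen (\<Union>n. A n)"
  shows "\<exists>n. (\<Union>n. A n) = A n"
proof -
  obtain S where S: "finite S" "S \<subseteq> (\<Union>n. A n)" "zspan S = (\<Union>n. A n)"
    using assms(3) by (auto simp: fin_gen_def)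
  then obtain m where m: "\<And>s. s \<in> S \<Longrightarrow> s \<in> A (m s)" by (metis UN_E subsetD)
  have "S \<subseteq> A (Max (m ` S))"
  proof
    fix s assume "s \<in> S"
    then have "m s \<le> Max (m ` S)" using S(1) by simp
    then show "s \<in> A (Max (m ` S))" using m[OF \<open>s \<in> S\<close>] \<open>incseq A\<close> by (auto dest: incseqD)
  qed
  then have "zspan S \<subseteq> A (Max (m ` S))" using sub by (rule zmod.span_minimal)
  then show ?thesis using S(3) by blast
qed

lemma zspan_imageE:
  assumes "finite I" "x \<in> zspan (f ` I)"
  obtains c where "x = (\<Sum>i\<in>I. of_int (c i) * f i)"
proof -
  have "\<exists>c. x = (\<Sum>i\<in>I. of_int (c i) * f i)"
    using assms
  proof (induction I arbitrary: x rule: finite_induct)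
    case (insert j I)
    then obtain k where "x - of_int k * f j \<in> zspan (f ` I)" by (auto simp: zmod.span_insert)
    then obtain c where "x - of_int k * f j = (\<Sum>i\<in>I. of_int (c i) * f i)"
      using insert.IH by blast
    also have "\<dots> = (\<Sum>i\<in>I. of_int ((c(j := k)) i) * f i)"
      using insert.hyps(2) by (intro sum.cong) auto
    finally have "x = of_int k * f j + (\<Sum>i\<in>I. of_int ((c(j := k)) i) * f i)"
      by (simp add: diff_eq_eq add.commute)
    then show ?case using insert.hyps by (intro exI[of _ "c(j := k)"]) simp
  qed simp
  then show ?thesis using that by blast
qed

lemma zintegral_of_fin_gen:
  assumes R: "unital_subring R" "fin_gen R" and x: "x \<in> R"
  shows "zintegral x"
proof -
  define A where "A n = zspan ((\<lambda>i. x ^ i) ` {..<n})" for n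
  have inc: "incseq A" unfolding A_def by (intro incseq_SucI zmod.span_mono) auto
  have "x ^ i \<in> R" for i
    using R(1) x by (induction i) (auto simp: unital_subring_def)
  then have "(\<Union>n. A n) \<subseteq> R"
    unfolding A_def using R(1) by (intro UN_least zmod.span_minimal) (auto simp: unital_subring_def)
  moreover have "add_subgroup (\<Union>n. A n)"
    unfolding add_subgroup_def
  proof (intro conjI ballI; (elim UN_E)?)
    show "0 \<in> (\<Union>n. A n)" by (auto simp: A_def zmod.span_zero)
    show "- a \<in> (\<Union>n. A n)" if "a \<in> A n" for a n
      using that by (auto simp: A_def intro: zmod.span_neg)
    fix a b m n assume "a \<in> A m" "b \<in> A n"
    then have "a \<in> A (max m n)" "b \<in> A (max m n)"
      using incseqD[OF inc, of m "max m n"] incseqD[OF inc, of n "max m n"] by auto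
    then have "a + b \<in> A (max m n)" unfolding A_def by (rule zmod.span_add)
    then show "a + b \<in> (\<Union>n. A n)" by blast
  qed
  ultimately have "fin_gen (\<Union>n. A n)" by (rule fin_gen_subgroup[OF R(2), rotated])
  then obtain n where n: "(\<Union>n. A n) = A n"
    using fin_gen_chain_stabilizes[OF inc] unfolding A_def by blast
  have "x ^ n \<in> A (Suc n)" unfolding A_def by (intro zmod.span_base) simp
  then have "x ^ n \<in> A n" using n by blast
  then obtain c where "x ^ n = (\<Sum>i<n. of_int (c i) * x ^ i)"
    unfolding A_def by (rule zspan_imageE[OF finite_lessThan])
  then have "x ^ n + (\<Sum>i<n. of_int (- c i) * x ^ i) = 0" by (simp add: sum_negf)
  then show ?thesis unfolding zintegral_def by (intro exI[of _ n] exI[of _ "\<lambda>i. - c i"])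
qed

section \<open>Full subgroups\<close>

definition full_subgroup :: "'a::ring_1 set \<Rightarrow> bool" where
  "full_subgroup H \<longleftrightarrow> add_subgroup H \<and> (\<forall>x. \<exists>n::nat. n > 0 \<and> of_nat n * x \<in> H)"

lemma full_subgroup_imp_add_subgroup: "full_subgroup H \<Longrightarrow> add_subgroup H"
  by (simp add: full_subgroup_def)

lemma full_subgroup_multiple:
  assumes "full_subgroup H"
  obtains n :: nat where "n > 0" "of_nat n * x \<in> H"
  using assms unfolding full_subgroup_def by blast

lemma full_subgroup_mono: "full_subgroup G \<Longrightarrow> G \<subseteq> H \<Longrightarrow> add_subgroup H \<Longrightarrow> full_subgroup H"
  unfolding full_subgroup_def by blast

lemma full_subgroup_common_multiple:
  assumes H: "full_subgroup H" and S: "finite S"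
  obtains n :: nat where "n > 0" "\<forall>s\<in>S. of_nat n * s \<in> H"
proof -
  have "\<exists>n::nat. n > 0 \<and> (\<forall>s\<in>S. of_nat n * s \<in> H)"
    using S
  proof (induction S)
    case empty
    show ?case by (intro exI[of _ 1]) simp
  next
    case (insert s S)
    then obtain n where n: "n > 0" "\<forall>s\<in>S. of_nat n * s \<in> H" by blast
    obtain m where m: "m > 0" "of_nat m * (of_nat n * s) \<in> H"
      using H by (rule full_subgroup_multiple)
    have "of_nat (m * n) * t \<in> H" if "t \<in> insert s S" for t
      using that n m H by (auto simp: mult.assoc full_subgroup_def intro: add_subgroup_of_nat_mult)
    then show ?case using n(1) m(1) by (intro exI[of _ "m * n"]) simp
  qed
  then show thesis using that by blast
qed

lemma full_subgroup_Int:
  assumes G: "full_subgroup G" and H: "full_subgroup H"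
  shows "full_subgroup (G \<inter> H)"
  unfolding full_subgroup_def
proof (intro conjI allI)
  show "add_subgroup (G \<inter> H)"
    using G H by (simp add: full_subgroup_imp_add_subgroup zmod.subspace_inter)
  fix x
  obtain m where m: "m > 0" "of_nat m * x \<in> G" using G by (rule full_subgroup_multiple)
  obtain n where n: "n > 0" "of_nat n * (of_nat m * x) \<in> H" using H by (rule full_subgroup_multiple)
  have "of_nat n * (of_nat m * x) \<in> G"
    using m(2) G by (simp add: full_subgroup_imp_add_subgroup add_subgroup_of_nat_mult)
  then show "\<exists>k::nat. k > 0 \<and> of_nat k * x \<in> G \<inter> H"
    using m(1) n by (intro exI[of _ "n * m"]) (simp add: mult.assoc)
qed

lemma full_subgroup_INT:
  assumes "finite I" "full_subgroup G" "\<And>i. i \<in> I \<Longrightarrow> full_subgroup (H i)"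
  shows "full_subgroup (G \<inter> (\<Inter>i\<in>I. H i))"
  using assms
proof (induction I)
  case (insert i I)
  have "G \<inter> (\<Inter>j\<in>insert i I. H j) = H i \<inter> (G \<inter> (\<Inter>j\<in>I. H j))" by auto
  then show ?case using insert by (simp add: full_subgroup_Int)
qed simp

lemma full_subgroup_vimage:
  assumes f: "additive f" and H: "full_subgroup H"
  shows "full_subgroup (f -` H)"
  unfolding full_subgroup_def
proof (intro conjI allI)
  show "add_subgroup (f -` H)"
    using f H by (simp add: add_subgroup_vimage full_subgroup_imp_add_subgroup)
  fix x
  show "\<exists>n::nat. n > 0 \<and> of_nat n * x \<in> f -` H"
    using full_subgroup_multiple[OF H, of "f x"] by (metis f additive_of_nat_mult vimageI)
qed

lemma full_subgroup_image:
  assumes f: "additive f" "surj f" and H: "full_subgroup H"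
  shows "full_subgroup (f ` H)"
  unfolding full_subgroup_def
proof (intro conjI allI)
  show "add_subgroup (f ` H)"
    using f H by (simp add: add_subgroup_image full_subgroup_imp_add_subgroup)
  fix y
  obtain x where "y = f x" using f(2) by blast
  then show "\<exists>n::nat. n > 0 \<and> of_nat n * y \<in> f ` H"
    using full_subgroup_multiple[OF H, of x] by (metis f(1) additive_of_nat_mult imageI)
qed

lemma full_subgroup_if_finite_index:
  assumes G: "full_subgroup G" and H: "add_subgroup H" and fin: "finite_index H G"
  shows "full_subgroup H"
  unfolding full_subgroup_def
proof (intro conjI allI H)
  fix x
  obtain n where n: "n > 0" "of_nat n * x \<in> G" using G by (rule full_subgroup_multiple)
  define coset where "coset j = (+) (of_nat j * (of_nat n * x)) ` H" for j :: nat
  have "range coset \<subseteq> (\<lambda>x. (+) x ` H) ` G"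
    using add_subgroup_of_nat_mult[OF full_subgroup_imp_add_subgroup[OF G] n(2)]
    by (auto simp: coset_def)
  then have "finite (range coset)" using fin unfolding finite_index_def by (rule finite_subset)
  then have "\<not> inj coset" using range_inj_infinite by blast
  then obtain i j where ij: "i < j" "coset j = coset i" by (metis inj_def linorder_neqE_nat)
  then have "of_nat j * (of_nat n * x) - of_nat i * (of_nat n * x) \<in> H"
    unfolding coset_def coset_eq_iff[OF H] by blast
  then have "of_nat ((j - i) * n) * x \<in> H"
    using ij(1) by (simp add: left_diff_distrib mult.assoc)
  then show "\<exists>n::nat. n > 0 \<and> of_nat n * x \<in> H"
    using ij(1) n(1) by (intro exI[of _ "(j - i) * n"]) simp
qed

lemma finite_index_full_subgroup:
  assumes H: "full_subgroup H" and G: "fin_gen G"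
  shows "finite_index H G"
proof -
  have sub: "add_subgroup H" using H by (rule full_subgroup_imp_add_subgroup)
  obtain T where "finite T" "zspan T = G" using G by (auto simp: fin_gen_def)
  moreover have "finite ((\<lambda>x. (+) x ` H) ` zspan T)"
    using \<open>finite T\<close>
  proof (induction T)
    case (insert t T)
    obtain m where m: "m > 0" "of_nat m * t \<in> H" using H by (rule full_subgroup_multiple)
    have "(\<lambda>x. (+) x ` H) ` zspan (insert t T)
        \<subseteq> (\<lambda>(r, X). (+) (of_int r * t) ` X) ` ({0..<int m} \<times> (\<lambda>x. (+) x ` H) ` zspan T)"
    proof safe
      fix x assume "x \<in> zspan (insert t T)"
      then obtain k where k: "x - of_int k * t \<in> zspan T" by (auto simp: zmod.span_insert)
      define q r where "q = k div int m" and "r = k mod int m"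
      have "k = q * int m + r" by (simp add: q_def r_def)
      then have "x - (of_int r * t + (x - of_int k * t)) = of_int q * (of_nat m * t)"
        by (simp add: algebra_simps)
      then have "x - (of_int r * t + (x - of_int k * t)) \<in> H"
        using add_subgroup_of_int_mult[OF sub m(2)] by simp
      then have "(+) x ` H = (+) (of_int r * t + (x - of_int k * t)) ` H"
        by (simp only: coset_eq_iff[OF sub])
      also have "\<dots> = (+) (of_int r * t) ` (+) (x - of_int k * t) ` H"
        by (simp only: image_image add.assoc cong: image_cong_simp)
      finally have "(+) x ` H = (+) (of_int r * t) ` (+) (x - of_int k * t) ` H" .
      moreover have "(r, (+) (x - of_int k * t) ` H) \<in> {0..<int m} \<times> (\<lambda>x. (+) x ` H) ` zspan T"
        using k m(1) by (simp add: r_def)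
      ultimately show "(+) x ` H
          \<in> (\<lambda>(r, X). (+) (of_int r * t) ` X) ` ({0..<int m} \<times> (\<lambda>x. (+) x ` H) ` zspan T)"
        by (intro image_eqI[of _ _ "(r, (+) (x - of_int k * t) ` H)"]) (simp_all only: prod.case)
    qed
    then show ?case by (rule finite_subset) (use insert.IH in simp)
  qed simp
  ultimately show ?thesis by (simp add: finite_index_def)
qed

section \<open>Units\<close>

lemma qinv_right: "qunit a \<Longrightarrow> a * qinv a = 1"
  and qinv_left: "qunit a \<Longrightarrow> qinv a * a = 1"
proof -
  assume "qunit a"
  then obtain y where y: "a * y = 1 \<and> y * a = 1" by (auto simp: qunit_def)
  then have "a * qinv a = 1 \<and> qinv a * a = 1"
    unfolding qinv_def by (rule theI) (metis y mult.assoc mult_1)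
  then show "a * qinv a = 1" "qinv a * a = 1" by simp_all
qed

lemma qunit_mult_cancel: "qunit a \<Longrightarrow> a * x = a * y \<longleftrightarrow> x = y"
  by (metis mult.assoc mult_1 qinv_left)

lemma qunit_surj_mult: "qunit a \<Longrightarrow> surj ((*) a)"
  by (metis mult.assoc mult_1 qinv_right surjI)

section \<open>The ambient rational vector space\<close>

locale rational_lattice =
  fixes R :: "'a::ring_1 set"
  assumes R_subgroup: "add_subgroup R" and R_fin_gen: "fin_gen R" and R_QR: "is_QR R"
begin

lemma of_nat_divide:
  assumes "n > 0"
  shows "\<exists>y::'a. of_nat n * y = x"
proof -
  obtain z :: 'a where "of_nat n * z = 1" using assms R_QR unfolding is_QR_def by blast
  then have "of_nat n * (z * x) = x" by (simp add: mult.assoc[symmetric])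
  then show ?thesis by blast
qed

lemma of_nat_mult_cancel:
  assumes "n > 0"
  shows "of_nat n * x = of_nat n * y \<longleftrightarrow> x = (y::'a)"
proof -
  obtain z :: 'a where "z * of_nat n = 1" using assms R_QR unfolding is_QR_def by blast
  then show ?thesis by (metis mult.assoc mult_1)
qed

lemma of_int_mult_cancel:
  assumes "k > 0"
  shows "of_int k * x = of_int k * y \<longleftrightarrow> x = (y::'a)"
  using of_nat_mult_cancel[of "nat k"] assms by simp

lemma full_R: "full_subgroup R"
  using R_subgroup R_QR by (auto simp: full_subgroup_def is_QR_def)

lemma additive_eq_on_full:
  fixes f g :: "'b::ring_1 \<Rightarrow> 'a"
  assumes H: "full_subgroup H" and f: "additive f" and g: "additive g"
    and eq: "\<And>x. x \<in> H \<Longrightarrow> f x = g x"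
  shows "f x = g x"
proof -
  obtain n where n: "n > 0" "of_nat n * x \<in> H" using H by (rule full_subgroup_multiple)
  then have "of_nat n * f x = of_nat n * g x"
    using eq additive_of_nat_mult[OF f] additive_of_nat_mult[OF g] by metis
  then show ?thesis using of_nat_mult_cancel[OF n(1)] by blast
qed

lemma additive_injI_on_full:
  fixes f :: "'a \<Rightarrow> 'b::ring_1"
  assumes H: "full_subgroup H" and f: "additive f" and ker: "\<And>x. x \<in> H \<Longrightarrow> f x = 0 \<Longrightarrow> x = 0"
  shows "inj f"
proof (rule injI)
  fix x y assume "f x = f y"
  obtain n where n: "n > 0" "of_nat n * (x - y) \<in> H" using H by (rule full_subgroup_multiple)
  have "f (of_nat n * (x - y)) = of_nat n * (f x - f y)"
    by (simp only: additive_of_nat_mult[OF f] additive.diff[OF f])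
  then have "of_nat n * (x - y) = of_nat n * 0" using ker[OF n(2)] \<open>f x = f y\<close> by simp
  then have "x - y = 0" using of_nat_mult_cancel[OF n(1)] by blast
  then show "x = y" by simp
qed

lemma additive_eq_on_span:
  fixes f g :: "'b::ring_1 \<Rightarrow> 'a"
  assumes S: "full_subgroup (zspan S)" and f: "additive f" and g: "additive g"
    and eq: "\<And>s. s \<in> S \<Longrightarrow> f s = g s"
  shows "f x = g x"
proof (rule additive_eq_on_full[OF S f g])
  have "additive (\<lambda>x. f x - g x)"
    by (rule additive.intro) (simp add: additive.add[OF f] additive.add[OF g])
  then have "add_subgroup ((\<lambda>x. f x - g x) -` {0})" by (rule add_subgroup_vimage) simp
  moreover have "S \<subseteq> (\<lambda>x. f x - g x) -` {0}" using eq by auto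
  ultimately have "zspan S \<subseteq> (\<lambda>x. f x - g x) -` {0}" by (rule zmod.span_minimal[rotated])
  then show "f x = g x" if "x \<in> zspan S" for x using that by auto
qed

lemma additive_on_full_extends_at:
  fixes f :: "'b::ring_1 \<Rightarrow> 'a"
  assumes H: "full_subgroup H" and f: "\<And>x y. x \<in> H \<Longrightarrow> y \<in> H \<Longrightarrow> f (x + y) = f x + f y"
  shows "\<exists>y. \<forall>n>0. of_nat n * x \<in> H \<longrightarrow> of_nat n * y = f (of_nat n * x)"
proof -
  have sub: "add_subgroup H" using H by (rule full_subgroup_imp_add_subgroup)
  have f_zero: "f 0 = 0" using f[of 0 0] zmod.subspace_0[OF sub] by simp
  have f_mult: "f (of_nat n * z) = of_nat n * f z" if "z \<in> H" for n z
  proof (induction n)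
    case (Suc n)
    then show ?case using that by (simp add: distrib_right f add_subgroup_of_nat_mult[OF sub])
  qed (simp add: f_zero)
  obtain m where m: "m > 0" "of_nat m * x \<in> H" using H by (rule full_subgroup_multiple)
  obtain y where y: "of_nat m * y = f (of_nat m * x)" using of_nat_divide[OF m(1)] by blast
  have "of_nat n * y = f (of_nat n * x)" if n: "of_nat n * x \<in> H" for n
  proof -
    have "of_nat m * (of_nat n * y) = of_nat n * f (of_nat m * x)"
      using y zmod.scale_left_commute[of "int m" "int n" y] by simp
    also have "\<dots> = f (of_nat n * (of_nat m * x))" using f_mult m(2) by simp
    also have "\<dots> = f (of_nat m * (of_nat n * x))"
      using zmod.scale_left_commute[of "int m" "int n" x] by simp
    also have "\<dots> = of_nat m * f (of_nat n * x)" using f_mult n by simp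
    finally show ?thesis using of_nat_mult_cancel[OF m(1)] by blast
  qed
  then show ?thesis by blast
qed

lemma additive_extension:
  fixes f :: "'b::ring_1 \<Rightarrow> 'a"
  assumes H: "full_subgroup H" and f: "\<And>x y. x \<in> H \<Longrightarrow> y \<in> H \<Longrightarrow> f (x + y) = f x + f y"
  obtains g where "additive g" "\<forall>x\<in>H. g x = f x"
proof -
  have "\<forall>x. \<exists>y. \<forall>n>0. of_nat n * x \<in> H \<longrightarrow> of_nat n * y = f (of_nat n * x)"
    using additive_on_full_extends_at[OF H f] by blast
  then obtain g where g: "\<And>n x. n > 0 \<Longrightarrow> of_nat n * x \<in> H \<Longrightarrow> of_nat n * g x = f (of_nat n * x)"
    by metis
  have "additive g"
  proof (rule additive.intro)
    fix x y
    obtain n where n: "n > 0" "\<forall>z\<in>{x, y}. of_nat n * z \<in> H"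
      by (rule full_subgroup_common_multiple[OF H, of "{x, y}"]) auto
    then have "of_nat n * (x + y) \<in> H"
      using zmod.subspace_add[OF full_subgroup_imp_add_subgroup[OF H]] by (simp add: distrib_left)
    then have "of_nat n * g (x + y) = f (of_nat n * x + of_nat n * y)"
      using g n(1) by (simp add: distrib_left)
    also have "\<dots> = of_nat n * (g x + g y)" using f n g by (simp add: distrib_left)
    finally show "g (x + y) = g x + g y" using of_nat_mult_cancel[OF n(1)] by blast
  qed
  moreover have "\<forall>x\<in>H. g x = f x" using g[of 1] by simp
  ultimately show thesis by (rule that)
qed

definition qscale :: "rat \<Rightarrow> 'a \<Rightarrow> 'a" where
  "qscale q x = (THE y. of_int (snd (quotient_of q)) * y = of_int (fst (quotient_of q)) * x)"

lemma qscale_fraction: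
  obtains a b where "b > 0" "of_int b * q = of_int a" "\<forall>x. of_int b * qscale q x = of_int a * x"
proof -
  obtain a b where ab: "quotient_of q = (a, b)" by fastforce
  then have b: "b > 0" by (rule quotient_of_denom_pos)
  have "\<exists>y. of_int b * y = of_int a * x" for x :: 'a
    using of_nat_divide[of "nat b"] b by simp
  then have "\<exists>!y. of_int b * y = of_int a * x" for x :: 'a
    using of_int_mult_cancel[OF b] by metis
  then have "of_int b * qscale q x = of_int a * x" for x
    unfolding qscale_def ab fst_conv snd_conv by (rule theI')
  moreover have "of_int b * q = of_int a" using quotient_of_div[OF ab] b by simp
  ultimately show thesis using b that by blast
qed

lemma qscale_eqI:
  assumes b: "b > 0" and q: "of_int b * q = of_int a" and y: "of_int b * y = of_int a * x"
  shows "qscale q x = y"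
proof -
  obtain c d where cd: "d > 0" "of_int d * q = of_int c" "\<forall>x. of_int d * qscale q x = of_int c * x"
    by (rule qscale_fraction[of q])
  have "of_int (c * b) = (of_int (a * d) :: rat)" using q cd(2) by (simp add: mult_ac flip: q cd(2))
  then have cb: "c * b = a * d" by (simp only: of_int_eq_iff)
  have "of_int (d * b) * qscale q x = of_int (c * b) * x"
    by (metis cd(3) mult.commute mult.assoc of_int_mult)
  also have "\<dots> = of_int (d * b) * y"
    unfolding cb by (metis y mult.commute mult.assoc of_int_mult)
  finally show ?thesis using of_int_mult_cancel[of "d * b"] b cd(1) by simp
qed

sublocale rat: vector_space qscale
proof
  fix q r x y
  obtain a b where ab: "b > 0" "of_int b * q = of_int a" "\<forall>x. of_int b * qscale q x = of_int a * x"
    by (rule qscale_fraction[of q])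
  obtain c d where cd: "d > 0" "of_int d * r = of_int c" "\<forall>x. of_int d * qscale r x = of_int c * x"
    by (rule qscale_fraction[of r])
  show "qscale q (x + y) = qscale q x + qscale q y"
    by (rule qscale_eqI[OF ab(1,2)]) (simp add: distrib_left ab(3))
  show "qscale (q + r) x = qscale q x + qscale r x"
  proof (rule qscale_eqI)
    show "b * d > 0" using ab(1) cd(1) by simp
    show "of_int (b * d) * (q + r) = of_int (a * d + b * c)"
      by (simp add: algebra_simps flip: ab(2) cd(2))
    have "of_int (b * d) * (qscale q x + qscale r x)
        = of_int d * (of_int b * qscale q x) + of_int b * (of_int d * qscale r x)"
      by (simp add: distrib_left zmod.scale_left_commute mult.assoc)
    then show "of_int (b * d) * (qscale q x + qscale r x) = of_int (a * d + b * c) * x"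
      by (simp add: ab(3) cd(3) distrib_right zmod.scale_left_commute mult.assoc)
  qed
  show "qscale q (qscale r x) = qscale (q * r) x"
  proof (rule qscale_eqI[symmetric])
    show "b * d > 0" using ab(1) cd(1) by simp
    show "of_int (b * d) * (q * r) = of_int (a * c)"
      by (simp add: algebra_simps flip: ab(2) cd(2))
    have "of_int (b * d) * qscale q (qscale r x) = of_int d * (of_int b * qscale q (qscale r x))"
      by (simp add: zmod.scale_left_commute mult.assoc)
    also have "\<dots> = of_int a * (of_int d * qscale r x)" by (simp add: ab(3) zmod.scale_left_commute)
    finally show "of_int (b * d) * qscale q (qscale r x) = of_int (a * c) * x"
      by (simp add: cd(3) mult.assoc)
  qed
  show "qscale 1 x = x" by (rule qscale_eqI[of 1 _ 1]) simp_all
qed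

lemma qscale_of_int: "qscale (of_int k) x = of_int k * x"
  by (rule qscale_eqI[of 1]) simp_all

lemma additive_imp_linear:
  fixes f :: "'a \<Rightarrow> 'a"
  assumes f: "additive f"
  shows "Vector_Spaces.linear qscale qscale f"
proof (intro Vector_Spaces.linear_iff[THEN iffD2] conjI allI rat.vector_space_axioms)
  show "f (x + y) = f x + f y" for x y by (rule additive.add[OF f])
  show "f (qscale q x) = qscale q (f x)" for q x
  proof -
    obtain a b where ab: "b > 0" "of_int b * q = of_int a"
      "\<forall>x. of_int b * qscale q x = of_int a * x"
      by (rule qscale_fraction[of q])
    have "of_int b * f (qscale q x) = of_int a * f x"
      using ab(3) by (simp flip: additive_of_int_mult[OF f])
    then show ?thesis using qscale_eqI[OF ab(1,2)] by metis
  qed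
qed

lemma rat_span_add_subgroup:
  assumes H: "add_subgroup H"
  shows "rat.span H = {x. \<exists>n::nat. n > 0 \<and> of_nat n * x \<in> H}" (is "_ = ?D")
proof
  have "rat.subspace ?D"
  proof (rule rat.subspaceI)
    show "0 \<in> ?D" using zmod.subspace_0[OF H] by (auto intro: exI[of _ 1])
  next
    fix x y assume "x \<in> ?D" "y \<in> ?D"
    then obtain m n where mn: "m > 0" "of_nat m * x \<in> H" "n > 0" "of_nat n * y \<in> H" by blast
    have "of_nat (m * n) * (x + y) = of_nat n * (of_nat m * x) + of_nat m * (of_nat n * y)"
      by (simp add: distrib_left mult_of_nat_commute[of m] mult.assoc)
    also have "\<dots> \<in> H" using mn H by (simp add: zmod.subspace_add add_subgroup_of_nat_mult)
    finally show "x + y \<in> ?D" using mn by (auto intro: exI[of _ "m * n"])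
  next
    fix q x assume "x \<in> ?D"
    then obtain n where n: "n > 0" "of_nat n * x \<in> H" by blast
    obtain a b where ab: "b > 0" "of_int b * qscale q x = of_int a * x"
      by (rule qscale_fraction[of q]) blast
    have "of_nat (n * nat b) * qscale q x = of_nat n * (of_int a * x)"
      using ab by (simp add: mult.assoc)
    also have "\<dots> = of_int a * (of_nat n * x)"
      using zmod.scale_left_commute[of "int n" a x] by simp
    also have "\<dots> \<in> H" using H n(2) by (rule add_subgroup_of_int_mult)
    finally show "qscale q x \<in> ?D" using n(1) ab(1) by (auto intro: exI[of _ "n * nat b"])
  qed
  moreover have "H \<subseteq> ?D" by (auto intro: exI[of _ 1])
  ultimately show "rat.span H \<subseteq> ?D" by (rule rat.span_minimal[rotated])
  show "?D \<subseteq> rat.span H"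
  proof
    fix x assume "x \<in> ?D"
    then obtain n where n: "n > 0" "of_nat n * x \<in> H" by blast
    have "x = qscale (1 / of_nat n) (qscale (of_int (int n)) x)" using n(1) by simp
    also have "\<dots> = qscale (1 / of_nat n) (of_nat n * x)" unfolding qscale_of_int by simp
    also have "\<dots> \<in> rat.span H" using n(2) by (intro rat.span_scale rat.span_base)
    finally show "x \<in> rat.span H" .
  qed
qed

lemma full_subgroup_iff_span: "add_subgroup H \<Longrightarrow> full_subgroup H \<longleftrightarrow> rat.span H = UNIV"
  by (auto simp: full_subgroup_def rat_span_add_subgroup)

lemma finite_rat_basis: "\<exists>B. finite B \<and> rat.independent B \<and> rat.span B = UNIV"
proof -
  obtain T where T: "finite T" "zspan T = R" using R_fin_gen by (auto simp: fin_gen_def)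
  have "add_subgroup (rat.span T)"
    by (simp add: add_subgroup_def rat.span_zero rat.span_neg rat.span_add)
  then have "R \<subseteq> rat.span T" using T(2) rat.span_superset zmod.span_minimal by blast
  then have "rat.span R \<subseteq> rat.span T" by (rule rat.span_minimal) simp
  then have span_T: "rat.span T = UNIV" using full_R full_subgroup_iff_span[OF R_subgroup] by auto
  obtain B where B: "B \<subseteq> T" "rat.independent B" "T \<subseteq> rat.span B"
    by (rule rat.maximal_independent_subset)
  moreover have "rat.span B = UNIV"
    using rat.span_minimal[OF B(3) rat.subspace_span] span_T by auto
  ultimately show ?thesis using T(1) finite_subset by blast
qed

definition rat_basis :: "'a set" where
  "rat_basis = (SOME B. finite B \<and> rat.independent B \<and> rat.span B = UNIV)"

sublocale rat: finite_dimensional_vector_space qscale rat_basis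
  using someI_ex[OF finite_rat_basis, folded rat_basis_def] by unfold_locales auto

lemma additive_inj_imp_surj:
  fixes f :: "'a \<Rightarrow> 'a"
  assumes "additive f" "inj f"
  shows "surj f"
  using assms by (intro rat.linear_inj_imp_surj additive_imp_linear)

lemma full_subgroup_Ints_rat: "full_subgroup (\<int> :: rat set)"
  unfolding full_subgroup_def
proof (intro conjI allI)
  show "add_subgroup (\<int> :: rat set)" by (simp add: add_subgroup_def)
  fix q :: rat
  obtain a b where ab: "quotient_of q = (a, b)" by fastforce
  then have "b > 0" by (rule quotient_of_denom_pos)
  then have "of_nat (nat b) * q = of_int a" using quotient_of_div[OF ab] by simp
  then show "\<exists>n::nat. n > 0 \<and> of_nat n * q \<in> \<int>" using \<open>b > 0\<close> by (intro exI[of _ "nat b"]) simp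
qed

lemma zindep_iff_independent: "zindep S \<longleftrightarrow> rat.independent S"
proof
  assume S: "zindep S"
  show "rat.independent S"
    unfolding rat.independent_explicit_module
  proof (intro allI impI)
    fix t u v assume t: "finite t" "t \<subseteq> S" and u: "(\<Sum>v\<in>t. qscale (u v) v) = 0" and v: "v \<in> t"
    obtain n where n: "n > 0" "\<forall>q\<in>u ` t. of_nat n * q \<in> \<int>"
      using full_subgroup_Ints_rat finite_imageI[OF t(1)] by (rule full_subgroup_common_multiple)
    then have "\<forall>v\<in>t. \<exists>k. of_nat n * u v = of_int k" by (auto elim: Ints_cases)
    then obtain c where c: "\<And>v. v \<in> t \<Longrightarrow> of_nat n * u v = of_int (c v)" by metis
    have "(\<Sum>v\<in>t. of_int (c v) * v) = (\<Sum>v\<in>t. qscale (of_nat n * u v) v)"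
      by (intro sum.cong) (simp_all add: c qscale_of_int)
    also have "\<dots> = qscale (of_nat n) (\<Sum>v\<in>t. qscale (u v) v)" by (simp add: rat.scale_sum_right)
    finally have "(\<Sum>v\<in>t. of_int (c v) * v) = 0" using u by simp
    then have "c v = 0" using S t v unfolding zindep_def by blast
    then show "u v = 0" using c[OF v] n(1) by simp
  qed
next
  assume S: "rat.independent S"
  show "zindep S"
    unfolding zindep_def
  proof (intro allI impI ballI; elim conjE)
    fix F c s assume F: "finite F" "F \<subseteq> S" "(\<Sum>s\<in>F. of_int (c s) * s) = 0" "s \<in> F"
    then show "c s = 0"
      using rat.independentD[OF S, of F "\<lambda>s. of_int (c s)" s] by (simp add: qscale_of_int)
  qed
qed

lemma zrank_eq_dim: "zrank G = rat.dim G"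
  unfolding zrank_def zindep_iff_independent
proof (rule cSup_eq_maximum)
  obtain B where B: "B \<subseteq> G" "rat.independent B" "card B = rat.dim G"
    by (rule rat.basis_exists)
  then show "rat.dim G \<in> {card S |S. finite S \<and> S \<subseteq> G \<and> rat.independent S}"
    using rat.finiteI_independent[OF B(2)] by (intro CollectI exI[of _ B]) simp
  show "k \<le> rat.dim G" if "k \<in> {card S |S. finite S \<and> S \<subseteq> G \<and> rat.independent S}" for k
    using that rat.independent_card_le_dim by blast
qed

lemma full_subgroup_if_zrank_eq:
  fixes H :: "'a set"
  assumes "add_subgroup H" "zrank H = zrank R"
  shows "full_subgroup H"
proof -
  have "rat.span R = UNIV" using full_R R_subgroup by (simp add: full_subgroup_iff_span)
  then have "rat.dim H = rat.dimension" using assms(2) by (simp add: zrank_eq_dim rat.dim_eq_full)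
  then show ?thesis using assms(1) by (simp add: full_subgroup_iff_span rat.dim_eq_full)
qed

end

section \<open>The group of affine transformations\<close>

definition gmult :: "'a::ring_1 \<times> 'a \<Rightarrow> 'a \<times> 'a \<Rightarrow> 'a \<times> 'a" where
  "gmult g h = (fst g + snd g * fst h, snd g * snd h)"

lemma act_gmult: "act (gmult g h) x = act g (act h x)"
  by (simp add: act_def gmult_def distrib_left mult.assoc add.assoc)

lemma act_diff: "act g x - act g y = snd g * (x - y)"
  by (simp add: act_def right_diff_distrib)

lemma gpd_comp_eq: "gpd_comp (g, \<eta>) (h, \<xi>) = (gmult g h, \<xi>)"
  by (simp add: gpd_comp_def gmult_def)

locale lattice_action =
  fixes R M L :: "'a::ring_1 set"
  assumes R: "unital_subring R" "fin_gen R" "is_QR R"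
    and M: "abelian_submonoid_regular R M" "finite_index (zspan M) R"
    and L: "add_subgroup L" "L \<subseteq> R" "zrank L = zrank R" "\<forall>a\<in>M. \<forall>x\<in>L. a * x \<in> L"

sublocale lattice_action \<subseteq> rational_lattice R
  using R by unfold_locales (simp_all add: unital_subring_def)

context lattice_action
begin

lemma M_subset: "M \<subseteq> R" and M_one: "1 \<in> M" and M_mult: "a \<in> M \<Longrightarrow> b \<in> M \<Longrightarrow> a * b \<in> M"
  using M(1) by (auto simp: abelian_submonoid_regular_def left_regular_def)

lemma full_L: "full_subgroup L"
  using L(1,3) by (rule full_subgroup_if_zrank_eq)

lemma fin_gen_L: "fin_gen L"
  using R(2) L(1,2) by (rule fin_gen_subgroup)

lemma full_zspan_M: "full_subgroup (zspan M)"
  using full_R _ M(2) by (rule full_subgroup_if_finite_index) simp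

lemma mult_commute: "x * y = y * (x::'a)"
proof -
  have additive_mult_right: "additive (\<lambda>x. x * z)" for z :: 'a
    by (simp add: additive.intro distrib_right)
  have commute_M: "x * y = y * x" if "y \<in> M" for x y
  proof (rule additive_eq_on_span[OF full_zspan_M additive_mult_right additive_mult_left])
    show "a * y = y * a" if "a \<in> M" for a
      using M(1) \<open>a \<in> M\<close> \<open>y \<in> M\<close> by (simp add: abelian_submonoid_regular_def)
  qed
  show ?thesis
    by (rule additive_eq_on_span[OF full_zspan_M additive_mult_left additive_mult_right commute_M])
qed

lemma mult_left_commute: "x * (y * z) = y * (x * (z::'a))"
  by (metis mult.assoc mult_commute)

lemma qunit_if_injective_on_full:
  fixes b :: 'a
  assumes H: "full_subgroup H" and inj: "\<And>x. x \<in> H \<Longrightarrow> b * x = 0 \<Longrightarrow> x = 0"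
  shows "qunit b"
proof -
  have "inj ((*) b)" using H additive_mult_left inj by (rule additive_injI_on_full)
  then have "surj ((*) b)" by (rule additive_inj_imp_surj[OF additive_mult_left])
  then show ?thesis unfolding qunit_def by (metis mult_commute surjD)
qed

lemma qunit_M: "a \<in> M \<Longrightarrow> qunit a"
  using M(1) by (intro qunit_if_injective_on_full[OF full_R])
    (auto simp: abelian_submonoid_regular_def left_regular_def)

lemma qunit_if_inj_on_L: "inj_on ((*) b) L \<Longrightarrow> qunit b"
  using zmod.subspace_0[OF L(1)]
  by (intro qunit_if_injective_on_full[OF full_L]) (simp_all add: inj_on_def)

lemma grp_gen_fraction: "u \<in> grp_gen M \<Longrightarrow> \<exists>p\<in>M. \<exists>q\<in>M. p * u = q"
proof (induction rule: grp_gen.induct)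
  case (mult x y)
  then obtain p q r s where pqrs: "p \<in> M" "q \<in> M" "p * x = q" "r \<in> M" "s \<in> M" "r * y = s"
    by blast
  have "(p * r) * (x * y) = q * s" using pqrs(3,6) by (metis mult.assoc mult_left_commute)
  then show ?case using pqrs M_mult by blast
next
  case (inv a)
  then show ?case using M_one qinv_right[OF qunit_M] by blast
qed (use M_one in \<open>auto intro: bexI[of _ 1]\<close>)

lemma qunit_grp_gen:
  assumes "u \<in> grp_gen M"
  shows "qunit u"
proof -
  obtain p q where pq: "p \<in> M" "q \<in> M" "p * u = q" using grp_gen_fraction assms by blast
  then have "(qinv q * p) * u = 1" using qinv_left[OF qunit_M] by (simp add: mult.assoc)
  then show ?thesis unfolding qunit_def by (metis mult_commute)
qed

lemma MinvL_iff: "x \<in> MinvL M L \<longleftrightarrow> (\<exists>a\<in>M. a * x \<in> L)"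
proof
  assume "x \<in> MinvL M L"
  then obtain a y where "a \<in> M" "y \<in> L" "x = qinv a * y" by (auto simp: MinvL_def)
  then have "a * x = y" using qinv_right[OF qunit_M] by (simp flip: mult.assoc)
  then show "\<exists>a\<in>M. a * x \<in> L" using \<open>a \<in> M\<close> \<open>y \<in> L\<close> by blast
next
  assume "\<exists>a\<in>M. a * x \<in> L"
  then obtain a where "a \<in> M" "a * x \<in> L" by blast
  moreover have "x = qinv a * (a * x)"
    using qinv_left[OF qunit_M[OF \<open>a \<in> M\<close>]] by (simp flip: mult.assoc)
  ultimately show "x \<in> MinvL M L" unfolding MinvL_def by blast
qed

lemma grpG_gmult:
  assumes "g \<in> grpG M L" "h \<in> grpG M L"
  shows "gmult g h \<in> grpG M L"
proof -
  obtain b u c v where gh: "g = (b, u)" "h = (c, v)" by fastforce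
  obtain a p q e where apqe: "a \<in> M" "a * b \<in> L" "p \<in> M" "q \<in> M" "p * u = q" "e \<in> M" "e * c \<in> L"
    using assms grp_gen_fraction[of u] unfolding grpG_def gh by (auto simp: MinvL_iff)
  have "a * (p * e) * (b + u * c) = p * (e * (a * b)) + a * ((p * u) * (e * c))"
    by (simp add: distrib_left mult.assoc mult_left_commute)
  also have "\<dots> = p * (e * (a * b)) + a * (q * (e * c))" using apqe(5) by simp
  also have "\<dots> \<in> L" using apqe L(4) by (intro zmod.subspace_add[OF L(1)]) auto
  finally have "b + u * c \<in> MinvL M L" using apqe M_mult MinvL_iff by blast
  then show ?thesis using assms by (auto simp: grpG_def gmult_def gh intro: grp_gen.mult)
qed

lemma gmult_cancel_right:
  fixes g h k :: "'a \<times> 'a"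
  assumes "gmult g k = gmult h k" "qunit (snd k)"
  shows "g = h"
proof -
  have "snd k * snd g = snd k * snd h" using assms(1) mult_commute by (metis gmult_def snd_conv)
  then have "snd g = snd h" using qunit_mult_cancel assms(2) by blast
  then show ?thesis using assms(1) by (simp add: gmult_def prod_eq_iff)
qed

lemma translation_in_grpG: "b \<in> L \<Longrightarrow> (b, 1) \<in> grpG M L"
  and dilation_in_grpG: "a \<in> M \<Longrightarrow> (0, a) \<in> grpG M L"
  using M_one zmod.subspace_0[OF L(1)]
  by (auto simp: grpG_def MinvL_iff intro: grp_gen.intros bexI[of _ 1])

lemma dom0_translation: "b \<in> L \<Longrightarrow> dom0 L (b, 1) = L"
  and dom0_dilation: "a \<in> M \<Longrightarrow> dom0 L (0, a) = L"
  using L(1,4) by (auto simp: dom0_def act_def zmod.subspace_add)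

end

section \<open>The completed lattice\<close>

lemma openin_fibre_discrete:
  assumes f: "continuous_map X (discrete_topology Y) f" and x: "x \<in> topspace X"
  shows "openin X {y \<in> topspace X. f y = f x}"
proof -
  have "f x \<in> Y" using continuous_map_funspace[OF f] x by auto
  then show ?thesis using openin_continuous_map_preimage[OF f, of "{f x}"] by simp
qed

context lattice_action
begin

abbreviation \<C> where "\<C> \<equiv> constructible M L"
abbreviation Lbar where "Lbar \<equiv> Lbar_top M L"
abbreviation \<iota> where "\<iota> \<equiv> iota M L"

lemma constructible_full: "C \<in> \<C> \<Longrightarrow> full_subgroup C"
proof (induction rule: constructible.induct)
  case base
  show ?case by (rule full_L)
next
  case (mul C a)
  then show ?case by (intro full_subgroup_image additive_mult_left qunit_surj_mult qunit_M)
next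
  case (pre C a)
  then have "full_subgroup (L \<inter> (*) a -` C)"
    by (intro full_subgroup_Int full_L full_subgroup_vimage additive_mult_left)
  then show ?case by (simp add: Int_def vimage_def)
qed

lemma constructible_subgroup: "C \<in> \<C> \<Longrightarrow> add_subgroup C"
  by (intro full_subgroup_imp_add_subgroup constructible_full)

lemma finite_cosets: "C \<in> \<C> \<Longrightarrow> finite (cosets L C)"
  using finite_index_full_subgroup[OF constructible_full fin_gen_L]
  by (simp add: finite_index_def cosets_def)

lemma topspace_Lbar:
  "topspace Lbar = {\<xi> \<in> Pi\<^sub>E \<C> (cosets L). \<forall>C\<in>\<C>. \<forall>D\<in>\<C>. C \<subseteq> D \<longrightarrow> \<xi> C \<subseteq> \<xi> D}"
  by (auto simp: Lbar_top_def)

lemma iota_in_topspace: "x \<in> L \<Longrightarrow> \<iota> x \<in> topspace Lbar"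
  unfolding topspace_Lbar by (auto simp: iota_def cosets_def)

lemma iota_eq_iff: "C \<in> \<C> \<Longrightarrow> \<iota> x C = \<iota> y C \<longleftrightarrow> x - y \<in> C"
  by (simp add: iota_def coset_eq_iff constructible_subgroup)

lemma open_contains_cylinder:
  assumes U: "openin Lbar U" "\<xi> \<in> U"
  obtains F where "finite F" "F \<subseteq> \<C>"
    "\<forall>\<eta>\<in>topspace Lbar. (\<forall>C\<in>F. \<eta> C = \<xi> C) \<longrightarrow> \<eta> \<in> U"
proof -
  let ?P = "product_topology (\<lambda>C. discrete_topology (cosets L C)) \<C>"
  obtain V where V: "openin ?P V" "U = V \<inter> {\<xi>. \<forall>C\<in>\<C>. \<forall>D\<in>\<C>. C \<subseteq> D \<longrightarrow> \<xi> C \<subseteq> \<xi> D}"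
    using U(1) unfolding Lbar_top_def openin_subtopology by blast
  then have "\<xi> \<in> V" using U(2) by blast
  from bspec[OF V(1)[unfolded openin_product_topology_alt] this]
  obtain W where W: "finite {C \<in> \<C>. W C \<noteq> cosets L C}" "\<xi> \<in> Pi\<^sub>E \<C> W" "Pi\<^sub>E \<C> W \<subseteq> V"
    unfolding topspace_discrete_topology by (elim exE conjE) (rule that)
  define F where "F = {C \<in> \<C>. W C \<noteq> cosets L C}"
  have "\<eta> \<in> U" if \<eta>: "\<eta> \<in> topspace Lbar" "\<forall>C\<in>F. \<eta> C = \<xi> C" for \<eta>
  proof -
    have "\<eta> \<in> Pi\<^sub>E \<C> W"
    proof (rule PiE_I)
      show "\<eta> C \<in> W C" if "C \<in> \<C>" for C
        using that \<eta> W(2) unfolding topspace_Lbar by (cases "C \<in> F") (auto simp: F_def PiE_iff)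
      show "\<eta> C = undefined" if "C \<notin> \<C>" for C
        using that \<eta>(1) unfolding topspace_Lbar by (auto simp: PiE_iff extensional_def)
    qed
    then have "\<eta> \<in> V" using W(3) by (rule rev_subsetD)
    then show ?thesis using V(2) \<eta>(1) unfolding topspace_Lbar by simp
  qed
  then show thesis using W(1) by (intro that[of F]) (auto simp: F_def)
qed

lemma open_cylinder:
  assumes F: "finite F" "F \<subseteq> \<C>" and \<xi>: "\<xi> \<in> topspace Lbar"
  shows "openin Lbar {\<eta> \<in> topspace Lbar. \<forall>C\<in>F. \<eta> C = \<xi> C}"
proof -
  have single: "openin Lbar {\<eta> \<in> topspace Lbar. \<eta> C \<in> {\<xi> C}}" if C: "C \<in> \<C>" for C
  proof (rule openin_continuous_map_preimage[of Lbar "discrete_topology (cosets L C)"])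
    show "continuous_map Lbar (discrete_topology (cosets L C)) (\<lambda>\<eta>. \<eta> C)"
      unfolding Lbar_top_def using C
      by (intro continuous_map_from_subtopology continuous_map_product_projection)
    show "openin (discrete_topology (cosets L C)) {\<xi> C}" using C \<xi> unfolding topspace_Lbar by auto
  qed
  show ?thesis
    using F
  proof (induction F rule: finite_induct)
    case (insert C F)
    have "{\<eta> \<in> topspace Lbar. \<forall>D\<in>insert C F. \<eta> D = \<xi> D}
        = {\<eta> \<in> topspace Lbar. \<eta> C \<in> {\<xi> C}} \<inter> {\<eta> \<in> topspace Lbar. \<forall>D\<in>F. \<eta> D = \<xi> D}" by auto
    then show ?case using insert single by (simp add: openin_Int)
  qed simp
qed

lemma Hausdorff_Lbar: "Hausdorff_space Lbar"
  unfolding Lbar_top_def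
  by (intro Hausdorff_space_subtopology) (simp add: Hausdorff_space_product_topology)

lemma compact_Lbar: "compact_space Lbar"
proof -
  let ?P = "product_topology (\<lambda>C. discrete_topology (cosets L C)) \<C>"
  let ?S = "{\<xi>. \<forall>C\<in>\<C>. \<forall>D\<in>\<C>. C \<subseteq> D \<longrightarrow> \<xi> C \<subseteq> \<xi> D}"
  define J where "J = {(C, D). C \<in> \<C> \<and> D \<in> \<C> \<and> C \<subseteq> D}"
  define K where "K = (\<lambda>(C, D). {\<xi> \<in> topspace ?P. \<xi> C \<subseteq> \<xi> D})"
  have "closedin ?P (K (C, D))" if "(C, D) \<in> J" for C D
  proof -
    let ?Q = "prod_topology (discrete_topology (cosets L C)) (discrete_topology (cosets L D))"
    let ?T = "{(X, Y) \<in> cosets L C \<times> cosets L D. X \<subseteq> Y}"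
    have "closedin ?P {\<xi> \<in> topspace ?P. (\<xi> C, \<xi> D) \<in> ?T}"
    proof (rule closedin_continuous_map_preimage)
      show "continuous_map ?P ?Q (\<lambda>\<xi>. (\<xi> C, \<xi> D))"
        using that
        by (intro continuous_map_pairedI continuous_map_product_projection) (auto simp: J_def)
      show "closedin ?Q ?T" unfolding prod_topology_discrete_topology[symmetric] by auto
    qed
    also have "{\<xi> \<in> topspace ?P. (\<xi> C, \<xi> D) \<in> ?T} = K (C, D)"
      using that by (auto simp: K_def J_def PiE_iff)
    finally show ?thesis .
  qed
  moreover have "(L, L) \<in> J" by (simp add: J_def constructible.base)
  ultimately have "closedin ?P (\<Inter>p\<in>J. K p)" by (intro closedin_INT) auto
  moreover have "compact_space ?P"
    using finite_cosets
    by (auto simp: compact_space_product_topology compact_space_discrete_topology)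
  ultimately have "compactin ?P (\<Inter>p\<in>J. K p)" by (rule closedin_compact_space[rotated])
  moreover have "(\<Inter>p\<in>J. K p) = topspace ?P \<inter> ?S"
    using \<open>(L, L) \<in> J\<close> by (auto simp: J_def K_def simp del: topspace_product_topology)
  ultimately have "compact_space (subtopology ?P (topspace ?P \<inter> ?S))"
    by (simp only: compact_space_subtopology)
  then show ?thesis unfolding Lbar_top_def subtopology_restrict .
qed

lemma continuous_to_discrete_constant_on_cylinder:
  assumes K: "K \<subseteq> topspace Lbar" "\<xi> \<in> K"
    and f: "continuous_map (subtopology Lbar K) (discrete_topology Y) f"
  obtains F where "finite F" "F \<subseteq> \<C>" "\<forall>\<eta>\<in>K. (\<forall>C\<in>F. \<eta> C = \<xi> C) \<longrightarrow> f \<eta> = f \<xi>"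
proof -
  have "openin (subtopology Lbar K) {\<eta> \<in> topspace (subtopology Lbar K). f \<eta> = f \<xi>}"
    using f by (rule openin_fibre_discrete) (use K in auto)
  then obtain U where U: "openin Lbar U" "{\<eta> \<in> K. f \<eta> = f \<xi>} = U \<inter> K"
    unfolding openin_subtopology topspace_subtopology_subset[OF K(1)] by blast
  then have "\<xi> \<in> U" using K(2) by blast
  with U(1) obtain F where F: "finite F" "F \<subseteq> \<C>"
    "\<forall>\<eta>\<in>topspace Lbar. (\<forall>C\<in>F. \<eta> C = \<xi> C) \<longrightarrow> \<eta> \<in> U"
    by (rule open_contains_cylinder)
  have "f \<eta> = f \<xi>" if "\<eta> \<in> K" "\<forall>C\<in>F. \<eta> C = \<xi> C" for \<eta>
    using that F(3) U(2) K(1) by blast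
  then show thesis using F(1,2) that by blast
qed

lemma continuous_to_discrete_factors:
  assumes K: "closedin Lbar K" and f: "continuous_map (subtopology Lbar K) (discrete_topology Y) f"
  obtains F where "finite F" "F \<subseteq> \<C>"
    "\<forall>\<xi>\<in>K. \<forall>\<eta>\<in>K. (\<forall>C\<in>F. \<xi> C = \<eta> C) \<longrightarrow> f \<xi> = f \<eta>"
proof -
  have K_Lbar: "K \<subseteq> topspace Lbar" using K by (rule closedin_subset)
  have "\<exists>F. finite F \<and> F \<subseteq> \<C> \<and> (\<forall>\<eta>\<in>K. (\<forall>C\<in>F. \<eta> C = \<xi> C) \<longrightarrow> f \<eta> = f \<xi>)" if "\<xi> \<in> K" for \<xi>
    using continuous_to_discrete_constant_on_cylinder[OF K_Lbar that f] by metis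
  then obtain F where F: "\<And>\<xi>. \<xi> \<in> K \<Longrightarrow> finite (F \<xi>)" "\<And>\<xi>. \<xi> \<in> K \<Longrightarrow> F \<xi> \<subseteq> \<C>"
    "\<And>\<xi> \<eta>. \<xi> \<in> K \<Longrightarrow> \<eta> \<in> K \<Longrightarrow> \<forall>C\<in>F \<xi>. \<eta> C = \<xi> C \<Longrightarrow> f \<eta> = f \<xi>"
    by metis
  define cyl where "cyl \<xi> = {\<eta> \<in> topspace Lbar. \<forall>C\<in>F \<xi>. \<eta> C = \<xi> C}" for \<xi>
  have "compactin Lbar K" using compact_Lbar K by (rule closedin_compact_space)
  moreover have "\<forall>U\<in>cyl ` K. openin Lbar U"
    unfolding cyl_def using F(1,2) K_Lbar by (auto intro!: open_cylinder)
  moreover have "K \<subseteq> \<Union>(cyl ` K)" unfolding cyl_def using K_Lbar by blast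
  ultimately obtain V where V: "finite V" "V \<subseteq> cyl ` K" "K \<subseteq> \<Union>V"
    unfolding compactin_def by meson
  then obtain J where J: "finite J" "J \<subseteq> K" "V = cyl ` J" by (meson finite_subset_image)
  show thesis
  proof (rule that)
    show "finite (\<Union>(F ` J))" "\<Union>(F ` J) \<subseteq> \<C>" using J F(1,2) by auto
    show "\<forall>\<xi>\<in>K. \<forall>\<eta>\<in>K. (\<forall>C\<in>\<Union>(F ` J). \<xi> C = \<eta> C) \<longrightarrow> f \<xi> = f \<eta>"
    proof (intro ballI impI)
      fix \<xi> \<eta> assume \<xi>\<eta>: "\<xi> \<in> K" "\<eta> \<in> K" "\<forall>C\<in>\<Union>(F ` J). \<xi> C = \<eta> C"
      then obtain \<zeta> where \<zeta>: "\<zeta> \<in> J" "\<xi> \<in> cyl \<zeta>" using V(3) J(3) by auto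
      then have "\<forall>C\<in>F \<zeta>. \<xi> C = \<zeta> C" "\<forall>C\<in>F \<zeta>. \<eta> C = \<zeta> C" using \<xi>\<eta>(3) by (auto simp: cyl_def)
      then have "f \<xi> = f \<zeta>" "f \<eta> = f \<zeta>" using F(3) \<xi>\<eta> \<zeta>(1) J(2) by blast+
      then show "f \<xi> = f \<eta>" by simp
    qed
  qed
qed

end

section \<open>The partial action on the completed lattice\<close>

context lattice_action
begin

definition approach :: "'a \<times> 'a \<Rightarrow> ('a set \<Rightarrow> 'a set) \<Rightarrow> 'a filter" where
  "approach h \<xi> = inf (filtercomap \<iota> (nhdsin Lbar \<xi>)) (principal (dom0 L h))"

lemma eventually_approach:
  assumes \<xi>: "\<xi> \<in> topspace Lbar"
  shows "eventually P (approach h \<xi>) \<longleftrightarrow>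
    (\<exists>U. openin Lbar U \<and> \<xi> \<in> U \<and> (\<forall>y\<in>dom0 L h. \<iota> y \<in> U \<longrightarrow> P y))" (is "_ \<longleftrightarrow> ?R")
proof
  assume "eventually P (approach h \<xi>)"
  then obtain Q where Q: "eventually Q (nhdsin Lbar \<xi>)" "\<And>y. Q (\<iota> y) \<Longrightarrow> y \<in> dom0 L h \<Longrightarrow> P y"
    unfolding approach_def eventually_inf_principal eventually_filtercomap by blast
  then obtain U where "openin Lbar U" "\<xi> \<in> U" "\<forall>\<eta>\<in>U. Q \<eta>"
    using \<xi> unfolding eventually_nhdsin by blast
  then show ?R using Q(2) by (intro exI[of _ U]) simp
next
  assume ?R
  then obtain U where U: "openin Lbar U" "\<xi> \<in> U" "\<forall>y\<in>dom0 L h. \<iota> y \<in> U \<longrightarrow> P y" by blast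
  then have "eventually (\<lambda>\<eta>. \<eta> \<in> U) (nhdsin Lbar \<xi>)" unfolding eventually_nhdsin by blast
  then show "eventually P (approach h \<xi>)"
    unfolding approach_def eventually_inf_principal eventually_filtercomap
    using U(3) by (intro exI[of _ "\<lambda>\<eta>. \<eta> \<in> U"]) simp
qed

lemma eventually_approach_dom0: "eventually (\<lambda>y. y \<in> dom0 L h) (approach h \<xi>)"
  by (simp add: approach_def eventually_inf_principal)

lemma eventually_approach_iota_eq:
  assumes "\<xi> \<in> topspace Lbar" "C \<in> \<C>"
  shows "eventually (\<lambda>y. \<iota> y C = \<xi> C) (approach h \<xi>)"
  unfolding eventually_approach[OF assms(1)]
  using assms open_cylinder[of "{C}" \<xi>]
  by (intro exI[of _ "{\<eta> \<in> topspace Lbar. \<forall>C\<in>{C}. \<eta> C = \<xi> C}"]) simp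

lemma pdom_in_topspace: "\<xi> \<in> pdom M L h \<Longrightarrow> \<xi> \<in> topspace Lbar"
  by (simp add: pdom_def in_closure_of)

lemma approach_neq_bot:
  assumes "\<xi> \<in> pdom M L h"
  shows "approach h \<xi> \<noteq> bot"
proof
  assume "approach h \<xi> = bot"
  then have "eventually (\<lambda>_. False) (approach h \<xi>)" by simp
  then obtain U where "openin Lbar U" "\<xi> \<in> U" "\<forall>y\<in>dom0 L h. \<iota> y \<notin> U"
    unfolding eventually_approach[OF pdom_in_topspace[OF assms]] by blast
  then show False using assms unfolding pdom_def in_closure_of by blast
qed

lemma pdomI:
  assumes \<xi>: "\<xi> \<in> topspace Lbar" and "approach h \<xi> \<noteq> bot"
    and dom0: "eventually (\<lambda>y. y \<in> dom0 L k) (approach h \<xi>)"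
  shows "\<xi> \<in> pdom M L k"
  unfolding pdom_def in_closure_of
proof (intro conjI allI impI \<xi>; elim conjE)
  fix U assume "\<xi> \<in> U" "openin Lbar U"
  then have "eventually (\<lambda>y. \<iota> y \<in> U) (approach h \<xi>)" unfolding eventually_approach[OF \<xi>] by blast
  then have "eventually (\<lambda>y. \<iota> y \<in> U \<and> y \<in> dom0 L k) (approach h \<xi>)"
    using dom0 by (rule eventually_conj)
  then show "\<exists>\<eta>. \<eta> \<in> \<iota> ` dom0 L k \<and> \<eta> \<in> U" using eventually_happens' assms(2) by blast
qed

lemma limitin_iotaI:
  assumes \<eta>: "\<eta> \<in> topspace Lbar" and f: "eventually (\<lambda>y. f y \<in> L) F"
    and agree: "\<And>D. D \<in> \<C> \<Longrightarrow> eventually (\<lambda>y. \<iota> (f y) D = \<eta> D) F"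
  shows "limitin Lbar (\<lambda>y. \<iota> (f y)) \<eta> F"
  unfolding limitin_def
proof (intro conjI allI impI \<eta>; elim conjE)
  fix U assume "openin Lbar U" "\<eta> \<in> U"
  then obtain G where G: "finite G" "G \<subseteq> \<C>" "\<forall>\<zeta>\<in>topspace Lbar. (\<forall>C\<in>G. \<zeta> C = \<eta> C) \<longrightarrow> \<zeta> \<in> U"
    by (rule open_contains_cylinder)
  have "eventually (\<lambda>y. \<forall>D\<in>G. \<iota> (f y) D = \<eta> D) F"
    using G(1,2) agree by (intro eventually_ball_finite) auto
  with f show "eventually (\<lambda>y. \<iota> (f y) \<in> U) F"
    by eventually_elim (use G(3) iota_in_topspace in blast)
qed

lemma act_uniformly_continuous:
  assumes g: "g \<in> grpG M L" and D: "D \<in> \<C>"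
  obtains E where "E \<in> \<C>" "\<forall>x y. x - y \<in> E \<longrightarrow> act g x - act g y \<in> D"
proof -
  obtain p q where pq: "p \<in> M" "q \<in> M" "p * snd g = q"
    using g grp_gen_fraction[of "snd g"] by (auto simp: grpG_def)
  define E where "E = {x \<in> L. q * x \<in> (*) p ` D}"
  have "act g x - act g y \<in> D" if "x - y \<in> E" for x y
  proof -
    obtain d where d: "d \<in> D" "q * (x - y) = p * d" using \<open>x - y \<in> E\<close> by (auto simp: E_def)
    then have "p * (snd g * (x - y)) = p * d" using pq(3) by (simp flip: mult.assoc)
    then show ?thesis using d(1) qunit_mult_cancel[OF qunit_M[OF pq(1)]] by (simp add: act_diff)
  qed
  moreover have "E \<in> \<C>" unfolding E_def using D pq by (intro constructible.intros)
  ultimately show thesis using that by blast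
qed

lemma act_eventually_constant:
  assumes h: "h \<in> grpG M L" and \<xi>: "\<xi> \<in> pdom M L h" and D: "D \<in> \<C>"
  shows "\<exists>X. eventually (\<lambda>y. \<iota> (act h y) D = X) (approach h \<xi>)"
proof -
  obtain E where E: "E \<in> \<C>" "\<forall>x y. x - y \<in> E \<longrightarrow> act h x - act h y \<in> D"
    using h D by (rule act_uniformly_continuous)
  have near: "eventually (\<lambda>y. \<iota> y E = \<xi> E) (approach h \<xi>)"
    using \<xi> E(1) by (intro eventually_approach_iota_eq pdom_in_topspace)
  then obtain x where x: "\<iota> x E = \<xi> E" using eventually_happens' approach_neq_bot[OF \<xi>] by blast
  from near have "eventually (\<lambda>y. \<iota> (act h y) D = \<iota> (act h x) D) (approach h \<xi>)"
  proof eventually_elim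
    case (elim y)
    then have "y - x \<in> E" using x E(1) by (simp flip: iota_eq_iff)
    then show ?case using E(2) D by (simp add: iota_eq_iff)
  qed
  then show ?thesis by blast
qed

lemma limitin_theta:
  assumes h: "h \<in> grpG M L" and \<xi>: "\<xi> \<in> pdom M L h"
  shows "limitin Lbar (\<lambda>y. \<iota> (act h y)) (theta M L h \<xi>) (approach h \<xi>)"
proof -
  have nontrivial: "approach h \<xi> \<noteq> bot" using \<xi> by (rule approach_neq_bot)
  obtain \<zeta> where \<zeta>: "\<And>D. D \<in> \<C> \<Longrightarrow> eventually (\<lambda>y. \<iota> (act h y) D = \<zeta> D) (approach h \<xi>)"
    using act_eventually_constant[OF h \<xi>] by metis
  define \<eta> where "\<eta> = restrict \<zeta> \<C>"
  have \<eta>: "eventually (\<lambda>y. \<iota> (act h y) D = \<eta> D) (approach h \<xi>)" if "D \<in> \<C>" for D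
    using \<zeta>[OF that] that by (simp add: \<eta>_def)
  have in_L: "eventually (\<lambda>y. act h y \<in> L) (approach h \<xi>)"
    using eventually_approach_dom0 by eventually_elim (simp add: dom0_def)
  have "\<eta> \<in> topspace Lbar"
    unfolding topspace_Lbar
  proof (intro CollectI conjI ballI impI)
    fix C D assume CD: "C \<in> \<C>" "D \<in> \<C>" "C \<subseteq> D"
    obtain y where "\<iota> (act h y) C = \<eta> C" "\<iota> (act h y) D = \<eta> D"
      using eventually_happens'[OF nontrivial eventually_conj[OF \<eta>[OF CD(1)] \<eta>[OF CD(2)]]] by blast
    then show "\<eta> C \<subseteq> \<eta> D" using CD by (auto simp: iota_def)
  next
    have "\<eta> D \<in> cosets L D" if D: "D \<in> \<C>" for D
    proof -
      obtain y where "act h y \<in> L" "\<iota> (act h y) D = \<eta> D"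
        using eventually_happens'[OF nontrivial eventually_conj[OF in_L \<eta>[OF D]]] by blast
      then show ?thesis using D by (auto simp: iota_def cosets_def)
    qed
    then show "\<eta> \<in> Pi\<^sub>E \<C> (cosets L)" by (auto simp: \<eta>_def)
  qed
  then have lim: "limitin Lbar (\<lambda>y. \<iota> (act h y)) \<eta> (approach h \<xi>)"
    using in_L \<eta> by (rule limitin_iotaI)
  then have "theta M L h \<xi> = \<eta>"
    unfolding theta_def approach_def[symmetric]
    using limitin_Hausdorff_unique[OF _ lim nontrivial Hausdorff_Lbar] by (rule the_equality)
  then show ?thesis using lim by simp
qed

lemma eventually_act_eq_theta:
  assumes h: "h \<in> grpG M L" and \<xi>: "\<xi> \<in> pdom M L h" and D: "D \<in> \<C>"
  shows "eventually (\<lambda>y. \<iota> (act h y) D = theta M L h \<xi> D) (approach h \<xi>)"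
proof -
  define U where "U = {\<eta> \<in> topspace Lbar. \<forall>C\<in>{D}. \<eta> C = theta M L h \<xi> C}"
  have "theta M L h \<xi> \<in> topspace Lbar" using limitin_theta[OF h \<xi>] by (simp add: limitin_def)
  then have "openin Lbar U" "theta M L h \<xi> \<in> U"
    unfolding U_def using D by (auto intro!: open_cylinder simp del: ball_simps)
  then have "eventually (\<lambda>y. \<iota> (act h y) \<in> U) (approach h \<xi>)"
    using limitin_theta[OF h \<xi>] by (simp add: limitin_def)
  then show ?thesis by eventually_elim (simp add: U_def)
qed

lemma iota_pdom: "x \<in> dom0 L h \<Longrightarrow> \<iota> x \<in> pdom M L h"
  unfolding pdom_def using closure_of_subset[of "\<iota> ` dom0 L h" Lbar] iota_in_topspace
  by (auto simp: dom0_def image_subset_iff)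

lemma theta_iota:
  assumes h: "h \<in> grpG M L" and x: "x \<in> dom0 L h"
  shows "theta M L h (\<iota> x) = \<iota> (act h x)"
proof (rule PiE_ext)
  have in_L: "x \<in> L" "act h x \<in> L" using x by (auto simp: dom0_def)
  show "theta M L h (\<iota> x) \<in> Pi\<^sub>E \<C> (cosets L)" "\<iota> (act h x) \<in> Pi\<^sub>E \<C> (cosets L)"
    using limitin_theta[OF h iota_pdom[OF x]] iota_in_topspace[OF in_L(2)]
    by (auto simp: limitin_def topspace_Lbar)
  fix D assume D: "D \<in> \<C>"
  obtain U where "\<iota> x \<in> U" "\<forall>y\<in>dom0 L h. \<iota> y \<in> U \<longrightarrow> \<iota> (act h y) D = theta M L h (\<iota> x) D"
    using eventually_act_eq_theta[OF h iota_pdom[OF x] D]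
    unfolding eventually_approach[OF iota_in_topspace[OF in_L(1)]] by blast
  then show "theta M L h (\<iota> x) D = \<iota> (act h x) D" using x by simp
qed

lemma pdom_gmult:
  assumes g: "g \<in> grpG M L" and h: "h \<in> grpG M L"
    and \<xi>: "\<xi> \<in> pdom M L h" and \<theta>: "theta M L h \<xi> \<in> pdom M L g"
  shows "\<xi> \<in> pdom M L (gmult g h)"
proof (rule pdomI)
  show "\<xi> \<in> topspace Lbar" using \<xi> by (rule pdom_in_topspace)
  show "approach h \<xi> \<noteq> bot" using \<xi> by (rule approach_neq_bot)
  obtain E where E: "E \<in> \<C>" "\<forall>x y. x - y \<in> E \<longrightarrow> act g x - act g y \<in> L"
    using g constructible.base by (rule act_uniformly_continuous)
  have "eventually (\<lambda>x. \<iota> x E = theta M L h \<xi> E) (approach g (theta M L h \<xi>))"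
    using \<theta> E(1) by (intro eventually_approach_iota_eq pdom_in_topspace)
  then obtain x where x: "\<iota> x E = theta M L h \<xi> E" "x \<in> dom0 L g"
    using eventually_happens'[OF approach_neq_bot[OF \<theta>]
        eventually_conj[OF _ eventually_approach_dom0]] by blast
  from eventually_act_eq_theta[OF h \<xi> E(1)] eventually_approach_dom0
  show "eventually (\<lambda>y. y \<in> dom0 L (gmult g h)) (approach h \<xi>)"
  proof eventually_elim
    case (elim y)
    then have "act h y - x \<in> E" using x(1) E(1) by (simp flip: iota_eq_iff)
    then have "act g x + (act g (act h y) - act g x) \<in> L"
      using x(2) E(2) by (intro zmod.subspace_add[OF L(1)]) (auto simp: dom0_def)
    then show ?case using elim by (simp add: dom0_def act_gmult)
  qed
qed

lemma gpd_comp_closed: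
  assumes "\<gamma> \<in> gpd_arrows M L" "\<delta> \<in> gpd_arrows M L" "gpd_src \<gamma> = gpd_rng M L \<delta>"
  shows "gpd_comp \<gamma> \<delta> \<in> gpd_arrows M L"
proof -
  obtain g \<eta> h \<xi> where "\<gamma> = (g, \<eta>)" "\<delta> = (h, \<xi>)" by fastforce
  then show ?thesis
    using assms grpG_gmult pdom_gmult
    by (auto simp: gpd_arrows_def gpd_src_def gpd_rng_def gpd_comp_eq)
qed

lemma topspace_gpd_top: "topspace (gpd_top M L) = gpd_arrows M L"
  by (auto simp: gpd_top_def gpd_arrows_def intro: pdom_in_topspace)

lemma continuous_map_fst_gpd: "continuous_map (gpd_top M L) (discrete_topology (grpG M L)) fst"
  unfolding gpd_top_def by (intro continuous_map_from_subtopology continuous_map_fst)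

lemma continuous_map_Pair_gpd:
  assumes "g \<in> grpG M L"
  shows "continuous_map (subtopology Lbar (pdom M L g)) (gpd_top M L) (Pair g)"
  unfolding gpd_top_def continuous_map_in_subtopology
proof
  show "continuous_map (subtopology Lbar (pdom M L g))
      (prod_topology (discrete_topology (grpG M L)) Lbar) (Pair g)"
    using assms by (intro continuous_map_pairedI continuous_map_from_subtopology) simp_all
qed (use assms in \<open>auto simp: gpd_arrows_def\<close>)

end

section \<open>The cocycle of a groupoid embedding\<close>

locale groupoid_embedding =
  A: lattice_action R1 M1 L1 + B: lattice_action R2 M2 L2
  for R1 M1 L1 :: "'a::ring_1 set" and R2 M2 L2 :: "'b::ring_1 set" +
  fixes \<Phi> :: "('a \<times> 'a) \<times> ('a set \<Rightarrow> 'a set) \<Rightarrow> ('b \<times> 'b) \<times> ('b set \<Rightarrow> 'b set)"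
  assumes inj_Phi: "inj_on \<Phi> (gpd_arrows M1 L1)"
    and Phi_arrows: "\<gamma> \<in> gpd_arrows M1 L1 \<Longrightarrow> \<Phi> \<gamma> \<in> gpd_arrows M2 L2"
    and cont_Phi: "continuous_map (gpd_top M1 L1) (gpd_top M2 L2) \<Phi>"
    and Phi_comp: "\<gamma> \<in> gpd_arrows M1 L1 \<Longrightarrow> \<delta> \<in> gpd_arrows M1 L1 \<Longrightarrow> gpd_src \<gamma> = gpd_rng M1 L1 \<delta>
      \<Longrightarrow> \<Phi> (gpd_comp \<gamma> \<delta>) = gpd_comp (\<Phi> \<gamma>) (\<Phi> \<delta>)"
begin

definition cocycle :: "'a \<times> 'a \<Rightarrow> 'a \<Rightarrow> 'b \<times> 'b" where
  "cocycle g x = fst (\<Phi> (g, A.\<iota> x))"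

lemma zero_in_L: "0 \<in> L1"
  using A.L(1) by (rule zmod.subspace_0)

lemma arrow_iota: "g \<in> grpG M1 L1 \<Longrightarrow> x \<in> dom0 L1 g \<Longrightarrow> (g, A.\<iota> x) \<in> gpd_arrows M1 L1"
  by (simp add: gpd_arrows_def A.iota_pdom)

lemma cocycle_in_grpG: "g \<in> grpG M1 L1 \<Longrightarrow> x \<in> dom0 L1 g \<Longrightarrow> cocycle g x \<in> grpG M2 L2"
  using Phi_arrows[OF arrow_iota, of g x] by (auto simp: cocycle_def gpd_arrows_def)

lemma qunit_cocycle: "g \<in> grpG M1 L1 \<Longrightarrow> x \<in> dom0 L1 g \<Longrightarrow> qunit (snd (cocycle g x))"
  using cocycle_in_grpG[of g x] B.qunit_grp_gen by (auto simp: grpG_def)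

lemma Phi_gmult:
  assumes "g \<in> grpG M1 L1" "h \<in> grpG M1 L1" "x \<in> dom0 L1 h" "act h x \<in> dom0 L1 g"
  shows "\<Phi> (gmult g h, A.\<iota> x) = (gmult (cocycle g (act h x)) (cocycle h x), snd (\<Phi> (h, A.\<iota> x)))"
  using Phi_comp[OF arrow_iota[OF assms(1,4)] arrow_iota[OF assms(2,3)]] A.theta_iota[OF assms(2,3)]
  by (simp add: gpd_src_def gpd_rng_def gpd_comp_def gmult_def cocycle_def)

lemma cocycle_gmult:
  assumes "g \<in> grpG M1 L1" "h \<in> grpG M1 L1" "x \<in> dom0 L1 h" "act h x \<in> dom0 L1 g"
  shows "cocycle (gmult g h) x = gmult (cocycle g (act h x)) (cocycle h x)"
  unfolding cocycle_def[of "gmult g h"] using Phi_gmult[OF assms] by simp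

lemma cocycle_one:
  assumes "x \<in> L1"
  shows "cocycle (0, 1) x = (0, 1)"
proof (rule B.gmult_cancel_right)
  note translation = A.translation_in_grpG[OF zero_in_L] A.dom0_translation[OF zero_in_L]
  show "gmult (cocycle (0, 1) x) (cocycle (0, 1) x) = gmult (0, 1) (cocycle (0, 1) x)"
    using cocycle_gmult[of "(0, 1)" "(0, 1)" x] translation assms by (simp add: gmult_def act_def)
  show "qunit (snd (cocycle (0, 1) x))" using translation assms by (intro qunit_cocycle) auto
qed

lemma cocycle_translation_add:
  assumes "b \<in> L1" "d \<in> L1" "x \<in> L1"
  shows "cocycle (b + d, 1) x = gmult (cocycle (b, 1) (d + x)) (cocycle (d, 1) x)"
  using cocycle_gmult[of "(b, 1)" "(d, 1)" x] assms
  by (simp add: A.translation_in_grpG A.dom0_translation act_def gmult_def zmod.subspace_add A.L(1))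

lemma cocycle_translation_minus:
  assumes "b \<in> L1" "x \<in> L1"
  shows "gmult (cocycle (- b, 1) x) (cocycle (b, 1) (x - b)) = (0, 1)"
  using cocycle_translation_add[of "- b" b "x - b"] assms A.L(1)
  by (simp add: cocycle_one zmod.subspace_neg zmod.subspace_diff)

lemma cocycle_uniform:
  assumes g: "g \<in> grpG M1 L1"
  obtains D where "full_subgroup D" "D \<subseteq> L1"
    "\<forall>x\<in>dom0 L1 g. \<forall>y\<in>dom0 L1 g. x - y \<in> D \<longrightarrow> cocycle g x = cocycle g y"
proof -
  let ?f = "fst \<circ> (\<Phi> \<circ> Pair g)"
  have "closedin A.Lbar (pdom M1 L1 g)" by (simp add: pdom_def)
  moreover
  have "continuous_map (subtopology A.Lbar (pdom M1 L1 g)) (discrete_topology (grpG M2 L2)) ?f"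
    using A.continuous_map_Pair_gpd[OF g] cont_Phi B.continuous_map_fst_gpd
    by (intro continuous_map_compose)
  ultimately obtain F where F: "finite F" "F \<subseteq> A.\<C>"
    "\<forall>\<xi>\<in>pdom M1 L1 g. \<forall>\<eta>\<in>pdom M1 L1 g. (\<forall>C\<in>F. \<xi> C = \<eta> C) \<longrightarrow> ?f \<xi> = ?f \<eta>"
    by (rule A.continuous_to_discrete_factors)
  show thesis
  proof (rule that)
    show "full_subgroup (L1 \<inter> (\<Inter>C\<in>F. C))"
      using F(1,2) A.constructible_full A.full_L by (intro full_subgroup_INT) auto
    show "\<forall>x\<in>dom0 L1 g. \<forall>y\<in>dom0 L1 g. x - y \<in> L1 \<inter> (\<Inter>C\<in>F. C) \<longrightarrow> cocycle g x = cocycle g y"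
    proof (intro ballI impI)
      fix x y assume xy: "x \<in> dom0 L1 g" "y \<in> dom0 L1 g" "x - y \<in> L1 \<inter> (\<Inter>C\<in>F. C)"
      then have "\<forall>C\<in>F. A.\<iota> x C = A.\<iota> y C" using F(2) by (simp add: A.iota_eq_iff subset_iff)
      then have "?f (A.\<iota> x) = ?f (A.\<iota> y)"
        using F(3) A.iota_pdom[OF xy(1)] A.iota_pdom[OF xy(2)] by blast
      then show "cocycle g x = cocycle g y" by (simp add: cocycle_def)
    qed
  qed simp
qed

definition periodic_translations :: "'a set \<Rightarrow> 'a set" where
  "periodic_translations H =
    {b \<in> L1. \<forall>x\<in>L1. \<forall>y\<in>L1. x - y \<in> H \<longrightarrow> cocycle (b, 1) x = cocycle (b, 1) y}"

lemma add_subgroup_periodic_translations: "add_subgroup (periodic_translations H)"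
  unfolding add_subgroup_def
proof (intro conjI ballI)
  show "0 \<in> periodic_translations H"
    using zero_in_L cocycle_one by (simp add: periodic_translations_def)
next
  fix b d assume bd: "b \<in> periodic_translations H" "d \<in> periodic_translations H"
  then have L: "b \<in> L1" "d \<in> L1" by (auto simp: periodic_translations_def)
  have "cocycle (b + d, 1) x = cocycle (b + d, 1) y" if xy: "x \<in> L1" "y \<in> L1" "x - y \<in> H" for x y
  proof -
    have "cocycle (d, 1) x = cocycle (d, 1) y"
      using bd(2) xy by (simp add: periodic_translations_def)
    moreover have "cocycle (b, 1) (d + x) = cocycle (b, 1) (d + y)"
      using bd(1) xy L(2) zmod.subspace_add[OF A.L(1)] by (simp add: periodic_translations_def)
    ultimately show ?thesis using L xy by (simp add: cocycle_translation_add)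
  qed
  then show "b + d \<in> periodic_translations H"
    using L zmod.subspace_add[OF A.L(1)] by (simp add: periodic_translations_def)
next
  fix b assume b: "b \<in> periodic_translations H"
  then have L: "b \<in> L1" "- b \<in> L1"
    using zmod.subspace_neg[OF A.L(1)] by (auto simp: periodic_translations_def)
  have "cocycle (- b, 1) x = cocycle (- b, 1) y" if xy: "x \<in> L1" "y \<in> L1" "x - y \<in> H" for x y
  proof (rule B.gmult_cancel_right)
    have mem: "x - b \<in> L1" "y - b \<in> L1" using xy L(1) zmod.subspace_diff[OF A.L(1)] by auto
    then have "cocycle (b, 1) (x - b) = cocycle (b, 1) (y - b)"
      using b xy(3) by (simp add: periodic_translations_def)
    then show "gmult (cocycle (- b, 1) x) (cocycle (b, 1) (y - b))
        = gmult (cocycle (- b, 1) y) (cocycle (b, 1) (y - b))"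
      using cocycle_translation_minus[OF L(1)] xy(1,2) by metis
    show "qunit (snd (cocycle (b, 1) (y - b)))"
      using L(1) mem(2) A.dom0_translation by (intro qunit_cocycle A.translation_in_grpG) auto
  qed
  then show "- b \<in> periodic_translations H" using L by (simp add: periodic_translations_def)
qed

definition common_period :: "'a set \<Rightarrow> bool" where
  "common_period H \<longleftrightarrow> full_subgroup H \<and> H \<subseteq> L1 \<and> L1 \<subseteq> periodic_translations H"

lemma exists_common_period: "\<exists>H. common_period H"
proof -
  obtain S where S: "finite S" "S \<subseteq> L1" "zspan S = L1" using A.fin_gen_L by (auto simp: fin_gen_def)
  have "\<exists>D. full_subgroup D \<and> b \<in> periodic_translations D" if "b \<in> S" for b
  proof -
    have b: "b \<in> L1" using S(2) that by blast
    obtain D where "full_subgroup D" "\<forall>x\<in>L1. \<forall>y\<in>L1. x - y \<in> D \<longrightarrow> cocycle (b, 1) x = cocycle (b, 1) y"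
      using cocycle_uniform[OF A.translation_in_grpG[OF b]]
      unfolding A.dom0_translation[OF b] by metis
    then show ?thesis using b by (auto simp: periodic_translations_def)
  qed
  then obtain D where D: "\<And>b. b \<in> S \<Longrightarrow> full_subgroup (D b) \<and> b \<in> periodic_translations (D b)"
    by metis
  define H where "H = L1 \<inter> (\<Inter>b\<in>S. D b)"
  have "S \<subseteq> periodic_translations H"
    using D by (fastforce simp: periodic_translations_def H_def)
  then have "L1 \<subseteq> periodic_translations H"
    using zmod.span_minimal[OF _ add_subgroup_periodic_translations] S(3) by blast
  moreover have "full_subgroup H"
    unfolding H_def using S(1) D A.full_L by (intro full_subgroup_INT) auto
  ultimately show ?thesis unfolding common_period_def H_def by blast
qed

definition \<rho> :: "'a \<Rightarrow> 'b \<times> 'b" where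
  "\<rho> b = cocycle (b, 1) 0"

lemma rho_zero: "\<rho> 0 = (0, 1)"
  by (simp add: \<rho>_def cocycle_one zero_in_L)

lemma rho_add:
  assumes H: "common_period H" and b: "b \<in> L1" and d: "d \<in> H"
  shows "\<rho> (b + d) = gmult (\<rho> b) (\<rho> d)"
proof -
  have "d \<in> L1" "b \<in> periodic_translations H" using H b d by (auto simp: common_period_def)
  then have "cocycle (b, 1) d = cocycle (b, 1) 0"
    using d zero_in_L by (simp add: periodic_translations_def)
  then show ?thesis
    using cocycle_translation_add[OF b \<open>d \<in> L1\<close> zero_in_L] by (simp add: \<rho>_def)
qed

lemma qunit_rho: "b \<in> L1 \<Longrightarrow> qunit (snd (\<rho> b))"
  unfolding \<rho>_def using zero_in_L A.dom0_translation
  by (intro qunit_cocycle A.translation_in_grpG) auto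

lemma rho_eq_one_iff:
  assumes b: "b \<in> L1"
  shows "\<rho> b = (0, 1) \<longleftrightarrow> b = 0"
proof
  assume rho: "\<rho> b = (0, 1)"
  note translation = A.translation_in_grpG A.dom0_translation zero_in_L b
  have "gmult (b, 1) (0, 1) = (b, 1)" by (simp add: gmult_def)
  then have "snd (\<Phi> ((b, 1), A.\<iota> 0)) = snd (\<Phi> ((0, 1), A.\<iota> 0))"
    using Phi_gmult[of "(b, 1)" "(0, 1)" 0] translation by (simp add: act_def)
  moreover have "fst (\<Phi> ((b, 1), A.\<iota> 0)) = fst (\<Phi> ((0, 1), A.\<iota> 0))"
    using rho rho_zero by (simp add: \<rho>_def cocycle_def)
  ultimately have "\<Phi> ((b, 1), A.\<iota> 0) = \<Phi> ((0, 1), A.\<iota> 0)" by (rule prod_eqI[rotated])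
  then have "((b, 1), A.\<iota> 0) = ((0, 1), A.\<iota> 0)"
    using inj_onD[OF inj_Phi] arrow_iota translation by blast
  then show "b = 0" by simp
qed (simp add: rho_zero)

lemma rho_dilation:
  assumes a: "a \<in> M1"
  obtains D where "full_subgroup D" "D \<subseteq> L1"
    "\<forall>b\<in>D. gmult (cocycle (0, a) 0) (\<rho> b) = gmult (\<rho> (a * b)) (cocycle (0, a) 0)"
proof -
  note domains = A.translation_in_grpG A.dilation_in_grpG
    A.dom0_translation A.dom0_dilation zero_in_L
  obtain D where D: "full_subgroup D" "D \<subseteq> L1"
    "\<forall>x\<in>L1. \<forall>y\<in>L1. x - y \<in> D \<longrightarrow> cocycle (0, a) x = cocycle (0, a) y"
    using cocycle_uniform[OF A.dilation_in_grpG[OF a]] unfolding A.dom0_dilation[OF a] by metis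
  have "gmult (cocycle (0, a) 0) (\<rho> b) = gmult (\<rho> (a * b)) (cocycle (0, a) 0)" if "b \<in> D" for b
  proof -
    have b: "b \<in> L1" "a * b \<in> L1" using that D(2) A.L(4) a by auto
    have "gmult (cocycle (0, a) 0) (\<rho> b) = gmult (cocycle (0, a) b) (cocycle (b, 1) 0)"
      using D(3) b(1) that zero_in_L by (simp add: \<rho>_def)
    also have "\<dots> = cocycle (gmult (0, a) (b, 1)) 0"
      using cocycle_gmult[of "(0, a)" "(b, 1)" 0] a b domains by (simp add: act_def)
    also have "\<dots> = cocycle (gmult (a * b, 1) (0, a)) 0" by (simp add: gmult_def)
    also have "\<dots> = gmult (\<rho> (a * b)) (cocycle (0, a) 0)"
      using cocycle_gmult[of "(a * b, 1)" "(0, a)" 0] a b domains by (simp add: act_def \<rho>_def)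
    finally show ?thesis .
  qed
  then show thesis using D(1,2) that by blast
qed

definition pure_translations :: "'a set \<Rightarrow> 'a set" where
  "pure_translations H = {b \<in> H. snd (\<rho> b) = 1}"

lemma pure_translations_subset: "common_period H \<Longrightarrow> pure_translations H \<subseteq> L1"
  by (auto simp: pure_translations_def common_period_def)

lemma rho_pure: "b \<in> pure_translations H \<Longrightarrow> \<rho> b = (fst (\<rho> b), 1)"
  by (simp add: pure_translations_def prod_eq_iff)

lemma add_subgroup_pure_translations:
  assumes H: "common_period H"
  shows "add_subgroup (pure_translations H)"
  unfolding add_subgroup_def
proof (intro conjI ballI)
  have sub: "add_subgroup H" and HL: "H \<subseteq> L1"
    using H by (auto simp: common_period_def full_subgroup_imp_add_subgroup)
  show "0 \<in> pure_translations H"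
    using zmod.subspace_0[OF sub] rho_zero by (simp add: pure_translations_def)
  show "b + d \<in> pure_translations H" if "b \<in> pure_translations H" "d \<in> pure_translations H" for b d
    using that rho_add[OF H, of b d] HL zmod.subspace_add[OF sub]
    by (auto simp: pure_translations_def gmult_def)
  show "- b \<in> pure_translations H" if "b \<in> pure_translations H" for b
    using that rho_add[OF H, of "- b" b] rho_zero HL zmod.subspace_neg[OF sub, of b]
    by (auto simp: pure_translations_def gmult_def)
qed

lemma full_subgroup_pure_translations:
  assumes H: "common_period H" and a: "a \<in> M1" "qunit (1 - a)"
  shows "full_subgroup (pure_translations H)"
proof -
  have sub: "add_subgroup H" and full: "full_subgroup H" and HL: "H \<subseteq> L1"
    using H by (auto simp: common_period_def full_subgroup_imp_add_subgroup)
  obtain D where D: "full_subgroup D" "D \<subseteq> L1"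
    "\<forall>b\<in>D. gmult (cocycle (0, a) 0) (\<rho> b) = gmult (\<rho> (a * b)) (cocycle (0, a) 0)"
    using a(1) by (rule rho_dilation)
  have "(1 - a) * d \<in> pure_translations H" if d: "d \<in> H \<inter> D \<inter> (*) a -` H" for d
  proof -
    have mem: "(1 - a) * d \<in> H" "a * d \<in> H" "d \<in> L1"
      using d HL zmod.subspace_diff[OF sub, of d "a * d"] by (auto simp: left_diff_distrib)
    have "qunit (snd (cocycle (0, a) 0))"
      using a(1) zero_in_L A.dom0_dilation by (intro qunit_cocycle A.dilation_in_grpG) auto
    moreover have "snd (cocycle (0, a) 0) * snd (\<rho> (a * d)) = snd (cocycle (0, a) 0) * snd (\<rho> d)"
      using D(3) d B.mult_commute by (metis IntE gmult_def snd_conv)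
    ultimately have "snd (\<rho> (a * d)) = snd (\<rho> d)" using qunit_mult_cancel by blast
    moreover have "\<rho> d = gmult (\<rho> ((1 - a) * d)) (\<rho> (a * d))"
      using rho_add[OF H, of "(1 - a) * d" "a * d"] mem HL by (auto simp: left_diff_distrib)
    ultimately have "snd (\<rho> d) * snd (\<rho> ((1 - a) * d)) = snd (\<rho> d) * 1"
      using B.mult_commute by (metis gmult_def mult_1_right snd_conv)
    then have "snd (\<rho> ((1 - a) * d)) = 1" using qunit_mult_cancel qunit_rho[OF mem(3)] by blast
    then show ?thesis using mem(1) by (simp add: pure_translations_def)
  qed
  then have "(*) (1 - a) ` (H \<inter> D \<inter> (*) a -` H) \<subseteq> pure_translations H" by blast
  moreover have "full_subgroup ((*) (1 - a) ` (H \<inter> D \<inter> (*) a -` H))"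
    using full D(1) a(2)
    by (intro full_subgroup_image full_subgroup_Int full_subgroup_vimage additive_mult_left
        qunit_surj_mult)
  ultimately show ?thesis
    using add_subgroup_pure_translations[OF H] full_subgroup_mono by blast
qed

lemma rho_extension_equivariant:
  assumes H: "common_period H" and full: "full_subgroup (pure_translations H)"
    and \<alpha>: "additive \<alpha>" "\<forall>b\<in>pure_translations H. \<alpha> b = fst (\<rho> b)" and u: "u \<in> M1"
  shows "\<exists>\<tau>\<in>grp_gen M2. \<forall>x. \<alpha> (u * x) = \<tau> * \<alpha> x"
proof -
  let ?N = "pure_translations H" and ?k = "cocycle (0, u) 0"
  obtain D where D: "full_subgroup D" "D \<subseteq> L1" "\<forall>b\<in>D. gmult ?k (\<rho> b) = gmult (\<rho> (u * b)) ?k"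
    using u by (rule rho_dilation)
  have "\<alpha> (u * x) = snd ?k * \<alpha> x" for x
  proof (rule B.additive_eq_on_full[where f = "\<lambda>x. \<alpha> (u * x)" and g = "\<lambda>x. snd ?k * \<alpha> x"])
    show "full_subgroup (?N \<inter> D \<inter> (*) u -` ?N)"
      using full D(1) by (intro full_subgroup_Int full_subgroup_vimage additive_mult_left)
    show "additive (\<lambda>x. \<alpha> (u * x))" "additive (\<lambda>x. snd ?k * \<alpha> x)"
      by (auto intro!: additive.intro simp: additive.add[OF \<alpha>(1)] distrib_left)
    fix b assume b: "b \<in> ?N \<inter> D \<inter> (*) u -` ?N"
    then have "gmult ?k (\<rho> b) = gmult (\<rho> (u * b)) ?k" using D(3) by blast
    then have "snd ?k * fst (\<rho> b) = fst (\<rho> (u * b))"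
      using b rho_pure[of "u * b"] by (simp add: gmult_def pure_translations_def)
    then show "\<alpha> (u * b) = snd ?k * \<alpha> b" using b \<alpha>(2) by simp
  qed
  moreover have "snd ?k \<in> grp_gen M2"
    using cocycle_in_grpG[of "(0, u)" 0] A.dilation_in_grpG[OF u] A.dom0_dilation[OF u] zero_in_L
    by (auto simp: grpG_def)
  ultimately show ?thesis by blast
qed

end

section \<open>From equivariant embeddings to algebra isomorphisms\<close>

definition equivariant_embedding :: "'a::ring_1 set \<Rightarrow> 'b::ring_1 set \<Rightarrow> ('a \<Rightarrow> 'b) \<Rightarrow> bool" where
  "equivariant_embedding M N \<alpha> \<longleftrightarrow>
    additive \<alpha> \<and> inj \<alpha> \<and> (\<forall>u\<in>M. \<exists>\<tau>\<in>grp_gen N. \<forall>x. \<alpha> (u * x) = \<tau> * \<alpha> x)"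

lemma (in groupoid_embedding) exists_equivariant_embedding:
  assumes "\<exists>a\<in>M1. inj_on (\<lambda>x. (1 - a) * x) L1"
  shows "\<exists>\<alpha>. equivariant_embedding M1 M2 \<alpha>"
proof -
  obtain H where H: "common_period H" using exists_common_period by blast
  obtain a where a: "a \<in> M1" "qunit (1 - a)" using assms A.qunit_if_inj_on_L by blast
  let ?N = "pure_translations H"
  have full: "full_subgroup ?N" using H a by (rule full_subgroup_pure_translations)
  have "fst (\<rho> (b + d)) = fst (\<rho> b) + fst (\<rho> d)" if "b \<in> ?N" "d \<in> ?N" for b d
    using that rho_add[OF H, of b d] pure_translations_subset[OF H]
    by (auto simp: pure_translations_def gmult_def)
  with full obtain \<alpha> where \<alpha>: "additive \<alpha>" "\<forall>b\<in>?N. \<alpha> b = fst (\<rho> b)"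
    by (rule B.additive_extension)
  have "inj \<alpha>"
  proof (rule A.additive_injI_on_full[OF full \<alpha>(1)])
    fix b assume b: "b \<in> ?N" "\<alpha> b = 0"
    then have "\<rho> b = (0, 1)" using rho_pure[OF b(1)] \<alpha>(2) by simp
    then show "b = 0" using rho_eq_one_iff pure_translations_subset[OF H] b(1) by blast
  qed
  then have "equivariant_embedding M1 M2 \<alpha>"
    using \<alpha>(1) rho_extension_equivariant[OF H full \<alpha>] by (simp add: equivariant_embedding_def)
  then show ?thesis by blast
qed

lemma zintegral_qalg_iso:
  assumes "qalg_iso \<phi>" "zintegral x"
  shows "zintegral (\<phi> x)"
proof -
  have hom: "additive \<phi>" "\<phi> 1 = 1" "\<And>x y. \<phi> (x * y) = \<phi> x * \<phi> y"
    using assms(1) by (auto simp: qalg_iso_def additive.intro)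
  have pow: "\<phi> (x ^ n) = \<phi> x ^ n" for n by (induction n) (simp_all add: hom(2,3))
  obtain n c where "x ^ n + (\<Sum>i<n. of_int (c i) * x ^ i) = 0"
    using assms(2) by (auto simp: zintegral_def)
  then have "\<phi> (x ^ n + (\<Sum>i<n. of_int (c i) * x ^ i)) = 0" using additive.zero[OF hom(1)] by simp
  then have "\<phi> x ^ n + (\<Sum>i<n. of_int (c i) * \<phi> x ^ i) = 0"
    by (simp add: additive.add[OF hom(1)] additive.sum[OF hom(1)] additive_of_int_mult[OF hom(1)]
        pow)
  then show ?thesis unfolding zintegral_def by (intro exI[of _ n] exI[of _ c])
qed

locale lattice_action_pair =
  A: lattice_action R1 M1 L1 + B: lattice_action R2 M2 L2
  for R1 M1 L1 :: "'a::ring_1 set" and R2 M2 L2 :: "'b::ring_1 set"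
begin

lemma equivariant_embedding_surj:
  assumes \<alpha>: "equivariant_embedding M1 M2 \<alpha>" and \<beta>: "equivariant_embedding M2 M1 \<beta>"
  shows "surj \<alpha>"
proof -
  have add: "additive \<alpha>" "additive \<beta>" and inj: "inj \<alpha>" "inj \<beta>"
    using \<alpha> \<beta> by (auto simp: equivariant_embedding_def)
  have "additive (\<alpha> \<circ> \<beta>)"
    by (rule additive.intro) (simp add: additive.add[OF add(1)] additive.add[OF add(2)])
  moreover have "inj (\<alpha> \<circ> \<beta>)" using inj by (rule inj_compose)
  ultimately have "surj (\<alpha> \<circ> \<beta>)" by (rule B.additive_inj_imp_surj)
  then have "(\<alpha> \<circ> \<beta>) (inv (\<alpha> \<circ> \<beta>) y) = y" for y by (rule surj_f_inv_f)
  then show ?thesis unfolding o_apply by (rule surjI)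
qed

lemma equivariant_embedding_mult:
  assumes \<alpha>: "equivariant_embedding M1 M2 \<alpha>"
  shows "\<alpha> (x * y) * \<alpha> 1 = \<alpha> x * \<alpha> y"
proof (rule B.additive_eq_on_span[OF A.full_zspan_M,
      where f = "\<lambda>x. \<alpha> (x * y) * \<alpha> 1" and g = "\<lambda>x. \<alpha> x * \<alpha> y"])
  have add: "additive \<alpha>" using \<alpha> by (simp add: equivariant_embedding_def)
  show "additive (\<lambda>x. \<alpha> (x * y) * \<alpha> 1)" "additive (\<lambda>x. \<alpha> x * \<alpha> y)"
    by (auto intro!: additive.intro simp: additive.add[OF add] distrib_right)
  fix u assume "u \<in> M1"
  then obtain \<tau> where \<tau>: "\<And>x. \<alpha> (u * x) = \<tau> * \<alpha> x"
    using \<alpha> unfolding equivariant_embedding_def by blast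
  from this[of 1] have "\<alpha> u = \<tau> * \<alpha> 1" by simp
  then show "\<alpha> (u * y) * \<alpha> 1 = \<alpha> u * \<alpha> y"
    using B.mult_commute[of "\<alpha> y" "\<alpha> 1"] by (simp add: \<tau>[of y] mult.assoc)
qed

lemma qunit_equivariant_embedding_one:
  assumes \<alpha>: "equivariant_embedding M1 M2 \<alpha>" and surj: "surj \<alpha>"
  shows "qunit (\<alpha> 1)"
proof -
  obtain e where "\<alpha> e = 1" using surj by (metis surjD)
  then have "\<alpha> (e * e) * \<alpha> 1 = 1" using equivariant_embedding_mult[OF \<alpha>, of e e] by simp
  then show ?thesis unfolding qunit_def by (metis B.mult_commute)
qed

lemma qalg_iso_normalized_embedding:
  assumes \<alpha>: "equivariant_embedding M1 M2 \<alpha>" and surj: "surj \<alpha>"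
  shows "qalg_iso (\<lambda>x. \<alpha> x * qinv (\<alpha> 1))"
proof -
  have add: "additive \<alpha>" and inj: "inj \<alpha>" using \<alpha> by (auto simp: equivariant_embedding_def)
  have unit: "\<alpha> 1 * qinv (\<alpha> 1) = 1" "qinv (\<alpha> 1) * \<alpha> 1 = 1"
    using qunit_equivariant_embedding_one[OF assms] by (simp_all add: qinv_right qinv_left)
  define \<phi> where "\<phi> x = \<alpha> x * qinv (\<alpha> 1)" for x
  have \<phi>_\<alpha>: "\<phi> x * \<alpha> 1 = \<alpha> x" for x by (simp add: \<phi>_def mult.assoc unit(2))
  have "bij \<phi>"
  proof (rule bijI)
    show "inj \<phi>" using inj \<phi>_\<alpha> by (metis injD injI)
    show "surj \<phi>"
    proof (rule surjI)
      fix y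
      have "\<alpha> (inv \<alpha> (y * \<alpha> 1)) = y * \<alpha> 1" using surj by (rule surj_f_inv_f)
      then show "\<phi> (inv \<alpha> (y * \<alpha> 1)) = y" by (simp add: \<phi>_def mult.assoc unit(1))
    qed
  qed
  moreover have "\<phi> 1 = 1" by (simp add: \<phi>_def unit(1))
  moreover have "\<phi> (x + y) = \<phi> x + \<phi> y" for x y
    by (simp add: \<phi>_def additive.add[OF add] distrib_right)
  moreover have "\<phi> (x * y) = \<phi> x * \<phi> y" for x y
  proof -
    have "\<phi> (x * y) = (\<alpha> (x * y) * \<alpha> 1) * (qinv (\<alpha> 1) * qinv (\<alpha> 1))"
      unfolding \<phi>_def by (metis unit(1) mult.assoc mult_1)
    also have "\<dots> = \<phi> x * \<phi> y"
      unfolding equivariant_embedding_mult[OF \<alpha>] \<phi>_def by (simp add: mult.assoc B.mult_left_commute)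
    finally show ?thesis .
  qed
  ultimately have "qalg_iso \<phi>" by (simp add: qalg_iso_def)
  then show ?thesis unfolding \<phi>_def .
qed

lemma exists_algebra_iso:
  assumes \<alpha>: "equivariant_embedding M1 M2 \<alpha>" and surj: "surj \<alpha>"
  shows "\<exists>\<phi>::'a \<Rightarrow> 'b. qalg_iso \<phi> \<and> \<phi> ` M1 \<subseteq> Mtilde M2"
proof -
  define \<phi> where "\<phi> x = \<alpha> x * qinv (\<alpha> 1)" for x
  have iso: "qalg_iso \<phi>" unfolding \<phi>_def by (rule qalg_iso_normalized_embedding[OF assms])
  have "\<phi> u \<in> Mtilde M2" if u: "u \<in> M1" for u
  proof -
    obtain \<tau> where \<tau>: "\<tau> \<in> grp_gen M2" "\<forall>x. \<alpha> (u * x) = \<tau> * \<alpha> x"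
      using \<alpha> u unfolding equivariant_embedding_def by blast
    from \<tau>(2)[rule_format, of 1] have "\<phi> u = \<tau>"
      using qunit_equivariant_embedding_one[OF assms] by (simp add: \<phi>_def mult.assoc qinv_right)
    moreover have "zintegral u" using zintegral_of_fin_gen[OF A.R(1,2)] A.M_subset u by blast
    then have "zintegral (\<phi> u)" using iso by (rule zintegral_qalg_iso[rotated])
    ultimately show ?thesis using \<tau>(1) by (simp add: Mtilde_def)
  qed
  then show ?thesis using iso by blast
qed

lemma exists_groupoid_embedding:
  assumes "groupoids_iso M1 L1 M2 L2"
  shows "\<exists>\<Phi>. groupoid_embedding R1 M1 L1 R2 M2 L2 \<Phi>"
proof -
  obtain \<Phi> where bij: "bij_betw \<Phi> (gpd_arrows M1 L1) (gpd_arrows M2 L2)"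
    and homeo: "homeomorphic_map (gpd_top M1 L1) (gpd_top M2 L2) \<Phi>"
    and comp: "\<forall>\<gamma>\<in>gpd_arrows M1 L1. \<forall>\<delta>\<in>gpd_arrows M1 L1. gpd_src \<gamma> = gpd_rng M1 L1 \<delta> \<longrightarrow>
      \<Phi> (gpd_comp \<gamma> \<delta>) = gpd_comp (\<Phi> \<gamma>) (\<Phi> \<delta>)"
    using assms unfolding groupoids_iso_def top_gpd_iso_def by blast
  have "groupoid_embedding R1 M1 L1 R2 M2 L2 \<Phi>"
    using bij homeomorphic_imp_continuous_map[OF homeo] comp
    by unfold_locales (auto simp: bij_betw_def)
  then show ?thesis by blast
qed

end

lemma top_gpd_iso_sym:
  assumes iso: "top_gpd_iso A1 T1 s1 r1 c1 A2 T2 s2 r2 c2" and T1: "topspace T1 = A1"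
    and closed: "\<And>\<gamma> \<delta>. \<gamma> \<in> A1 \<Longrightarrow> \<delta> \<in> A1 \<Longrightarrow> s1 \<gamma> = r1 \<delta> \<Longrightarrow> c1 \<gamma> \<delta> \<in> A1"
  shows "top_gpd_iso A2 T2 s2 r2 c2 A1 T1 s1 r1 c1"
proof -
  obtain \<Phi> where bij: "bij_betw \<Phi> A1 A2" and homeo: "homeomorphic_map T1 T2 \<Phi>"
    and comp: "\<forall>\<gamma>\<in>A1. \<forall>\<delta>\<in>A1. (s1 \<gamma> = r1 \<delta> \<longleftrightarrow> s2 (\<Phi> \<gamma>) = r2 (\<Phi> \<delta>)) \<and>
      (s1 \<gamma> = r1 \<delta> \<longrightarrow> \<Phi> (c1 \<gamma> \<delta>) = c2 (\<Phi> \<gamma>) (\<Phi> \<delta>))"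
    using iso unfolding top_gpd_iso_def by blast
  obtain \<Psi> where \<Psi>: "homeomorphic_maps T1 T2 \<Phi> \<Psi>"
    using homeo unfolding homeomorphic_map_maps by blast
  have T2: "topspace T2 = A2"
    using homeomorphic_imp_surjective_map[OF homeo] bij T1 by (simp add: bij_betw_def)
  have inverse: "\<And>\<gamma>. \<gamma> \<in> A1 \<Longrightarrow> \<Psi> (\<Phi> \<gamma>) = \<gamma>" "\<And>\<gamma>. \<gamma> \<in> A2 \<Longrightarrow> \<Phi> (\<Psi> \<gamma>) = \<gamma>"
    using \<Psi> by (auto simp: homeomorphic_maps_def T1 T2)
  have \<Psi>_homeo: "homeomorphic_map T2 T1 \<Psi>"
    using \<Psi> homeomorphic_maps_sym homeomorphic_map_maps by blast
  then have \<Psi>_image: "\<Psi> ` A2 = A1" using homeomorphic_imp_surjective_map T1 T2 by blast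
  have "bij_betw \<Psi> A2 A1" using \<Psi>_image inverse(2) by (metis bij_betw_imageI inj_on_inverseI)
  moreover have "(s2 \<gamma> = r2 \<delta> \<longleftrightarrow> s1 (\<Psi> \<gamma>) = r1 (\<Psi> \<delta>)) \<and>
      (s2 \<gamma> = r2 \<delta> \<longrightarrow> \<Psi> (c2 \<gamma> \<delta>) = c1 (\<Psi> \<gamma>) (\<Psi> \<delta>))" if "\<gamma> \<in> A2" "\<delta> \<in> A2" for \<gamma> \<delta>
  proof -
    have mem: "\<Psi> \<gamma> \<in> A1" "\<Psi> \<delta> \<in> A1" using that \<Psi>_image by auto
    have "s1 (\<Psi> \<gamma>) = r1 (\<Psi> \<delta>) \<longleftrightarrow> s2 \<gamma> = r2 \<delta>" using comp mem inverse(2) that by simp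
    moreover have "\<Psi> (c2 \<gamma> \<delta>) = c1 (\<Psi> \<gamma>) (\<Psi> \<delta>)" if "s1 (\<Psi> \<gamma>) = r1 (\<Psi> \<delta>)"
    proof -
      have "\<Phi> (c1 (\<Psi> \<gamma>) (\<Psi> \<delta>)) = c2 \<gamma> \<delta>"
        using comp mem inverse(2) \<open>\<gamma> \<in> A2\<close> \<open>\<delta> \<in> A2\<close> that by simp
      then show ?thesis using inverse(1)[OF closed[OF mem that]] by simp
    qed
    ultimately show ?thesis by blast
  qed
  ultimately show ?thesis unfolding top_gpd_iso_def using \<Psi>_homeo by blast
qed

lemma (in lattice_action) groupoids_iso_sym:
  "groupoids_iso M L M' L' \<Longrightarrow> groupoids_iso M' L' M L"
  unfolding groupoids_iso_def by (rule top_gpd_iso_sym[OF _ topspace_gpd_top gpd_comp_closed])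

theorem theorem5p3:
  fixes R1 M1 L1 :: "'a::ring_1 set" and R2 M2 L2 :: "'b::ring_1 set"
  assumes R1: "unital_subring R1" "fin_gen R1" "is_QR R1"
      and M1: "abelian_submonoid_regular R1 M1" "finite_index (zspan M1) R1"
      and L1: "add_subgroup L1" "L1 \<subseteq> R1" "zrank L1 = zrank R1" "\<forall>a\<in>M1. \<forall>x\<in>L1. a * x \<in> L1"
      and inj1: "\<exists>a\<in>M1. inj_on (\<lambda>x. (1 - a) * x) L1"
      and R2: "unital_subring R2" "fin_gen R2" "is_QR R2"
      and M2: "abelian_submonoid_regular R2 M2" "finite_index (zspan M2) R2"
      and L2: "add_subgroup L2" "L2 \<subseteq> R2" "zrank L2 = zrank R2" "\<forall>a\<in>M2. \<forall>x\<in>L2. a * x \<in> L2"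
      and inj2: "\<exists>a\<in>M2. inj_on (\<lambda>x. (1 - a) * x) L2"
      and iso: "groupoids_iso M1 L1 M2 L2"
  shows "\<exists>(\<phi>1::'a \<Rightarrow> 'b) (\<phi>2::'b \<Rightarrow> 'a). qalg_iso \<phi>1 \<and> qalg_iso \<phi>2 \<and>
           \<phi>1 ` M1 \<subseteq> Mtilde M2 \<and> \<phi>2 ` M2 \<subseteq> Mtilde M1"
proof -
  interpret A: lattice_action R1 M1 L1 using R1 M1 L1 by unfold_locales
  interpret B: lattice_action R2 M2 L2 using R2 M2 L2 by unfold_locales
  interpret AB: lattice_action_pair R1 M1 L1 R2 M2 L2 by unfold_locales
  interpret BA: lattice_action_pair R2 M2 L2 R1 M1 L1 by unfold_locales
  obtain \<Phi> where "groupoid_embedding R1 M1 L1 R2 M2 L2 \<Phi>"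
    using AB.exists_groupoid_embedding[OF iso] by blast
  then obtain \<alpha> where \<alpha>: "equivariant_embedding M1 M2 \<alpha>"
    using groupoid_embedding.exists_equivariant_embedding inj1 by blast
  obtain \<Psi> where "groupoid_embedding R2 M2 L2 R1 M1 L1 \<Psi>"
    using BA.exists_groupoid_embedding[OF A.groupoids_iso_sym[OF iso]] by blast
  then obtain \<beta> where \<beta>: "equivariant_embedding M2 M1 \<beta>"
    using groupoid_embedding.exists_equivariant_embedding inj2 by blast
  show ?thesis
    using AB.exists_algebra_iso[OF \<alpha> AB.equivariant_embedding_surj[OF \<alpha> \<beta>]]
      BA.exists_algebra_iso[OF \<beta> BA.equivariant_embedding_surj[OF \<beta> \<alpha>]] by blast
qed

end
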